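(* For every $t \ge 1$ and every $\mu \in \mathcal{M}$, the probability measure $\mathbb{B}_t(\mu) = \bigl( \mu^{\boxplus(1+t)} \bigr)^{\uplus(1/(1+t))}$ is infinitely divisible with respect to $\boxplus$.
   Context: $\mathcal{M}$ is the set of Borel probability measures on $\mathbb{R}$; $\mathbb{C}^+$ is the open upper half-plane. For $\mu \in \mathcal{M}$: $G_\mu(z) = \int_{\mathbb{R}} \frac{d\mu(s)}{z-s}$ is the Cauchy transform and $F_\mu(z) = 1/G_\mu(z)$ the reciprocal Cauchy transform; $F_\mu$ is an analytic self-map of $\mathbb{C}^+$. For every $\alpha>0$ there is $\beta>0$ such that $F_\mu$ has an analytic right inverse $F_\mu^{-1}$ on $\Gamma_{\alpha,\beta}=\{z\in\mathbb{C}^+ : |\Re z|<\alpha\,\Im z,\ \Im z>\beta\}$ with $F_\mu^{-1}(z)/z\to 1$ as $z\to\infty$ in $\Gamma_{\alpha,\beta}$; put $V_\mu(z) = F_\mu^{-1}(z)-z$ there. Free additive convolution $\boxplus$ is determined by $V_{\mu\boxplus\nu} = V_\mu+V_\nu$ on a common truncated cone. For $t\ge 1$, $\mu^{\boxplus t}\in\mathcal{M}$ is the unique probability measure with $V_{\mu^{\boxplus t}} = tV_\mu$ on a common truncated cone (it is known to exist). For $t>0$, the Boolean convolution power $\mu^{\uplus t}\in\mathcal{M}$ is the unique probability measure with $F_{\mu^{\uplus t}}(z) = tF_\mu(z)+(1-t)z$, $z\in\mathbb{C}^+$ (it always exists). A measure $\mu\in\mathcal{M}$ is infinitely divisible with respect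 to $\boxplus$ if for every $n\ge1$ there is $\mu_n\in\mathcal{M}$ with $\mu_n^{\boxplus n}=\mu$ ($n$-fold $\boxplus$-convolution). *)

theory Defs
  imports "HOL-Probability.Probability"
begin

text \<open>
  Borel probability measures on the real line are the measures satisfying the library
  predicate \<^const>\<open>real_distribution\<close>.
\<close>

definition cauchy_transform :: "real measure \<Rightarrow> complex \<Rightarrow> complex" where
  "cauchy_transform \<mu> z = (LINT s|\<mu>. 1 / (z - complex_of_real s))"

definition reciprocal_cauchy :: "real measure \<Rightarrow> complex \<Rightarrow> complex" where
  "reciprocal_cauchy \<mu> z = 1 / cauchy_transform \<mu> z"

definition truncated_cone :: "real \<Rightarrow> real \<Rightarrow> complex set" where
  "truncated_cone \<alpha> \<beta> = {z. Im z > 0 \<and> \<bar>Re z\<bar> < \<alpha> * Im z \<and> Im z > \<beta>}"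

text \<open>
  The right inverse is that of the self-map of the upper half-plane, so it takes values there.
\<close>

definition is_right_inverse_on_cone ::
    "real measure \<Rightarrow> real \<Rightarrow> real \<Rightarrow> (complex \<Rightarrow> complex) \<Rightarrow> bool" where
  "is_right_inverse_on_cone \<mu> \<alpha> \<beta> h \<longleftrightarrow>
     h holomorphic_on truncated_cone \<alpha> \<beta> \<and>
     (\<forall>z\<in>truncated_cone \<alpha> \<beta>. Im (h z) > 0 \<and> reciprocal_cauchy \<mu> (h z) = z) \<and>
     ((\<lambda>z. h z / z) \<longlongrightarrow> 1) (inf at_infinity (principal (truncated_cone \<alpha> \<beta>)))"

text \<open>
  The transform \<open>V\<close> of a measure lives only on some truncated cone (depending on the measure),
  so it is a relation: \<open>V\<close> is the transform of \<open>\<mu>\<close> on the cone with parameters \<open>\<alpha>\<close>, \<open>\<beta>\<close>.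
  On that cone, \<open>V\<close> is unique; its values outside are irrelevant.
\<close>

definition is_voiculescu_transform ::
    "real measure \<Rightarrow> real \<Rightarrow> real \<Rightarrow> (complex \<Rightarrow> complex) \<Rightarrow> bool" where
  "is_voiculescu_transform \<mu> \<alpha> \<beta> V \<longleftrightarrow>
     (\<exists>h. is_right_inverse_on_cone \<mu> \<alpha> \<beta> h \<and> (\<forall>z\<in>truncated_cone \<alpha> \<beta>. V z = h z - z))"

definition free_conv :: "real measure \<Rightarrow> real measure \<Rightarrow> real measure" where
  "free_conv \<mu> \<nu> = (THE \<rho>. real_distribution \<rho> \<and>
     (\<exists>\<alpha>>0. \<exists>\<beta>>0. \<exists>V\<^sub>\<mu> V\<^sub>\<nu> V\<^sub>\<rho>.
        is_voiculescu_transform \<mu> \<alpha> \<beta> V\<^sub>\<mu> \<and>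
        is_voiculescu_transform \<nu> \<alpha> \<beta> V\<^sub>\<nu> \<and>
        is_voiculescu_transform \<rho> \<alpha> \<beta> V\<^sub>\<rho> \<and>
        (\<forall>z\<in>truncated_cone \<alpha> \<beta>. V\<^sub>\<rho> z = V\<^sub>\<mu> z + V\<^sub>\<nu> z)))"

text \<open>The real-exponent power, meant for \<open>t \<ge> 1\<close>.\<close>

definition free_power :: "real measure \<Rightarrow> real \<Rightarrow> real measure" where
  "free_power \<mu> t = (THE \<rho>. real_distribution \<rho> \<and>
     (\<exists>\<alpha>>0. \<exists>\<beta>>0. \<exists>V\<^sub>\<mu> V\<^sub>\<rho>.
        is_voiculescu_transform \<mu> \<alpha> \<beta> V\<^sub>\<mu> \<and>
        is_voiculescu_transform \<rho> \<alpha> \<beta> V\<^sub>\<rho> \<and>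
        (\<forall>z\<in>truncated_cone \<alpha> \<beta>. V\<^sub>\<rho> z = complex_of_real t * V\<^sub>\<mu> z)))"

text \<open>Meant for \<open>t > 0\<close>.\<close>

definition boolean_power :: "real measure \<Rightarrow> real \<Rightarrow> real measure" where
  "boolean_power \<mu> t = (THE \<rho>. real_distribution \<rho> \<and>
     (\<forall>z. Im z > 0 \<longrightarrow> reciprocal_cauchy \<rho> z =
        complex_of_real t * reciprocal_cauchy \<mu> z + (1 - complex_of_real t) * z))"

definition B_transform :: "real \<Rightarrow> real measure \<Rightarrow> real measure" where
  "B_transform t \<mu> = boolean_power (free_power \<mu> (1 + t)) (1 / (1 + t))"

text \<open>The convolution of \<open>n\<close> copies of \<open>\<mu>\<close>, meant for \<open>n \<ge> 1\<close>.\<close>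

definition free_conv_nfold :: "nat \<Rightarrow> real measure \<Rightarrow> real measure" where
  "free_conv_nfold n \<mu> = (free_conv \<mu> ^^ (n - 1)) \<mu>"

definition free_infinitely_divisible :: "real measure \<Rightarrow> bool" where
  "free_infinitely_divisible \<mu> \<longleftrightarrow> real_distribution \<mu> \<and>
     (\<forall>n\<ge>1. \<exists>\<mu>\<^sub>n. real_distribution \<mu>\<^sub>n \<and> free_conv_nfold n \<mu>\<^sub>n = \<mu>)"

end

theory Submission
  imports Defs "HOL-Complex_Analysis.Complex_Analysis"
begin

text \<open>
  Write $F_\mu(z) = z + N(z)$. The functions $N$ arising in this way are exactly the holomorphic
  maps of the upper half-plane into its closure with $N(iy)/y \to 0$. For such $N$ and $c \ge 0$
  the map $w \mapsto w - c N(w)$ has an inverse $\omega_c$ from the half-plane into itself, and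
  $c\,N \circ \omega_c$ is again in the class. The free power $\mu^{\boxplus(1+t)}$ has
  $F(z) = z + (1+t) N(\omega_t(z))$, so $\mathbb{B}_t(\mu)$ has $F(z) = z + N(\omega_t(z))$.
  For $t \ge 1$ put $M = N \circ \omega_{t-1}$. Then $F$ is the inverse of $w \mapsto w - M(w)$, that is,
  $\mathbb{B}_t(\mu)$ has Voiculescu transform $-M$. The measures with reciprocal Cauchy
  transform inverse to $w \mapsto w - x M(w)$, $x \ge 0$, have Voiculescu transform $-x M$ and
  hence form a semigroup under free convolution.
\<close>

section \<open>The Schwarz--Pick inequality on the half-plane\<close>

text \<open>Why the inversion in the case t \<ge> 1 works: for w = \<omega>_t(z) and u = z + N(w),
  the relation z = w - t N(w) turns into u = w - (t - 1) N(w). Hence w = \<omega>_(t-1)(u), so M(u)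
  = N(w) and z = u - M(u). One unit of N is taken off the shift, and t - 1 \<ge> 0 keeps
  \<omega>_(t-1) available on the whole half-plane. The powers and the convolution are definite
  descriptions, so each measure must be shown to exist and to be determined by its transform.
  Existence is the harder half: 1 / (z + N(z)) need not have boundary values on the real line, so
  measures are built for its upward translates and the wanted one is their weak limit. One estimate
  carries most of the analysis: by Schwarz--Pick, |N(w) - N(w')| is at most |w - w'| times the
  geometric mean of Im N / Im at the two points. Injectivity, a priori bounds and growth on cones
  all come from it.\<close>

abbreviation uhp :: "complex set" where "uhp \<equiv> {z. Im z > 0}"

lemma open_uhp: "open uhp"
  by (rule open_halfspace_Im_gt)

lemma convex_uhp: "convex uhp"
  by (rule convex_halfspace_Im_gt)

text \<open>This converts the pseudo-hyperbolic distance |a - b| / |a - cnj b| of the half-plane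
  into imaginary parts, both to see that it is below 1 and to clear denominators.\<close>

lemma cmod_diff_cnj_squared: "(cmod (a - cnj b))\<^sup>2 = (cmod (a - b))\<^sup>2 + 4 * (Im a * Im b)"
  unfolding cmod_power2 by (simp add: power2_eq_square algebra_simps)

text \<open>Cayley maps centred at \<open>a\<close> and \<open>N a\<close> conjugate
  \<open>N\<close> to a self-map of the disc fixing 0, and the Schwarz lemma applies. The conclusion
  is squared and multiplied out so that no denominator obstructs the later passage to
  \<open>Im (N z) \<ge> 0\<close>.\<close>

lemma schwarz_pick_pos:
  assumes hol: "N holomorphic_on uhp" and pos: "\<And>z. Im z > 0 \<Longrightarrow> Im (N z) > 0"
    and w: "Im w > 0" and a: "Im a > 0"
  shows "(cmod (N w - N a))\<^sup>2 * (Im w * Im a) \<le> (cmod (w - a))\<^sup>2 * (Im (N w) * Im (N a))"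
proof -
  \<comment> \<open>\<open>\<psi>\<close> is the Cayley map from the disc to the half-plane taking \<open>0\<close> to \<open>a\<close>\<close>
  define \<psi> where "\<psi> \<zeta> = complex_of_real (Re a) + \<i> * of_real (Im a) * ((1 + \<zeta>) / (1 - \<zeta>))" for \<zeta>
  define b where "b = N a"
  define f where "f \<zeta> = (N (\<psi> \<zeta>) - b) / (N (\<psi> \<zeta>) - cnj b)" for \<zeta>
  have b: "Im b > 0" using pos a by (simp add: b_def)
  have ne1: "1 - \<zeta> \<noteq> 0" if "cmod \<zeta> < 1" for \<zeta>
    using that by auto
  have Re_pos: "Re ((1 + \<zeta>) / (1 - \<zeta>)) > 0" if "cmod \<zeta> < 1" for \<zeta>
  proof -
    have "Re ((1 + \<zeta>) / (1 - \<zeta>)) = (1 - (cmod \<zeta>)\<^sup>2) / (cmod (1 - \<zeta>))\<^sup>2"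
      unfolding Re_divide cmod_power2 by (simp add: power2_eq_square algebra_simps)
    moreover have "(cmod \<zeta>)\<^sup>2 < 1" using that by (simp add: power_less_one_iff abs_square_less_1)
    ultimately show ?thesis using ne1[OF that] by simp
  qed
  have psi: "Im (\<psi> \<zeta>) > 0" if "cmod \<zeta> < 1" for \<zeta>
  proof -
    have "Im (complex_of_real r + \<i> * of_real s * q) = s * Re q" for r s q
      by simp
    then show ?thesis
      unfolding \<psi>_def using Re_pos[OF that] a by (metis mult_pos_pos)
  qed
  have psihol: "\<psi> holomorphic_on ball 0 1"
    unfolding \<psi>_def by (intro holomorphic_intros) (use ne1 in auto)
  have Nhol: "(\<lambda>\<zeta>. N (\<psi> \<zeta>)) holomorphic_on ball 0 1"
  proof -
    have "\<psi> ` ball 0 1 \<subseteq> uhp" using psi by auto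
    then show ?thesis using holomorphic_on_compose_gen[OF psihol hol] by (simp add: o_def)
  qed
  have lt: "cmod (N z - b) < cmod (N z - cnj b)" if "Im z > 0" for z
  proof -
    have "(cmod (N z - b))\<^sup>2 < (cmod (N z - cnj b))\<^sup>2"
      using cmod_diff_cnj_squared[of "N z" b] pos[OF that] b by simp
    then show ?thesis by (rule power_less_imp_less_base) simp
  qed
  have fhol: "f holomorphic_on ball 0 1"
    unfolding f_def using lt psi by (intro holomorphic_intros Nhol) force
  have psi0: "\<psi> 0 = a" unfolding \<psi>_def by (simp add: complex_eq_iff)
  have f0: "f 0 = 0" by (simp add: f_def psi0 b_def)
  have f1: "cmod (f \<zeta>) < 1" if "cmod \<zeta> < 1" for \<zeta>
    using lt[OF psi[OF that]] unfolding f_def norm_divide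
    by (subst divide_less_eq_1_pos) (auto intro: le_less_trans[OF norm_ge_zero])
  define \<zeta> where "\<zeta> = (w - a) / (w - cnj a)"
  have Y: "(cmod (w - cnj a))\<^sup>2 = (cmod (w - a))\<^sup>2 + 4 * (Im w * Im a)" by (rule cmod_diff_cnj_squared)
  have wa: "w - cnj a \<noteq> 0"
  proof
    assume "w - cnj a = 0" then have "Im w = - Im a" by (simp add: complex_eq_iff)
    then show False using w a by simp
  qed
  have zeta1: "cmod \<zeta> < 1"
  proof -
    have "(cmod (w - a))\<^sup>2 < (cmod (w - cnj a))\<^sup>2" using Y w a by simp
    then have "cmod (w - a) < cmod (w - cnj a)" by (rule power_less_imp_less_base) simp
    then show ?thesis unfolding \<zeta>_def norm_divide using wa by simp
  qed
  have psiz: "\<psi> \<zeta> = w"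
  proof -
    have d: "a \<noteq> cnj a" using a by (auto simp: complex_eq_iff)
    have e1: "1 + \<zeta> = (2 * w - (a + cnj a)) / (w - cnj a)" and e2: "1 - \<zeta> = (a - cnj a) / (w - cnj a)"
      unfolding \<zeta>_def using wa by (auto simp: field_simps)
    have e3: "a + cnj a = 2 * complex_of_real (Re a)" "a - cnj a = 2 * \<i> * complex_of_real (Im a)"
      by (auto simp: complex_eq_iff)
    have "(1 + \<zeta>) / (1 - \<zeta>) = (2 * w - (a + cnj a)) / (a - cnj a)"
      unfolding e1 e2 using wa by simp
    also have "\<dots> = (w - of_real (Re a)) / (\<i> * of_real (Im a))"
      unfolding e3 using a by (simp add: field_simps)
    finally show ?thesis unfolding \<psi>_def using a by simp
  qed
  have "cmod (f \<zeta>) \<le> cmod \<zeta>"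
    by (rule Schwarz_Lemma(1)[OF fhol f0 f1 zeta1])
  then have le: "cmod (N w - b) / cmod (N w - cnj b) \<le> cmod (w - a) / cmod (w - cnj a)"
    unfolding f_def psiz by (simp add: \<zeta>_def norm_divide)
  have nb: "cmod (N w - cnj b) > 0" using lt[OF w] by (meson le_less_trans norm_ge_zero)
  have "cmod (N w - b) * cmod (w - cnj a) \<le> cmod (w - a) * cmod (N w - cnj b)"
    using le nb wa by (simp add: field_simps)
  then have "(cmod (N w - b) * cmod (w - cnj a))\<^sup>2 \<le> (cmod (w - a) * cmod (N w - cnj b))\<^sup>2"
    by (rule power_mono) simp
  \<comment> \<open>Expanding both squared distances to conjugates, the common term
    \<open>(cmod (N w - b))\<^sup>2 * (cmod (w - a))\<^sup>2\<close> cancels, and so does the factor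
    4.\<close>
  then show ?thesis
    unfolding power_mult_distrib Y cmod_diff_cnj_squared b_def by (simp add: algebra_simps)
qed

text \<open>Adding \<open>\<i> * of_real d\<close> moves \<open>N\<close> into the open half-plane;
  then d tends to 0 from the right. The degenerate case remains informative: if
  \<open>Im (N z)\<close> vanishes identically, the inequality says that \<open>N\<close> is
  constant.\<close>

lemma schwarz_pick:
  assumes hol: "N holomorphic_on uhp" and nn: "\<And>z. Im z > 0 \<Longrightarrow> Im (N z) \<ge> 0"
    and w: "Im w > 0" and a: "Im a > 0"
  shows "(cmod (N w - N a))\<^sup>2 * (Im w * Im a) \<le> (cmod (w - a))\<^sup>2 * (Im (N w) * Im (N a))"
proof -
  have "(cmod (N w - N a))\<^sup>2 * (Im w * Im a) \<le> (cmod (w - a))\<^sup>2 * ((Im (N w) + d) * (Im (N a) + d))"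
    if "d > 0" for d
  proof -
    have "(\<lambda>z. N z + \<i> * of_real d) holomorphic_on uhp"
      by (intro holomorphic_intros hol)
    moreover have "Im (N z + \<i> * of_real d) > 0" if "Im z > 0" for z
      using nn[OF that] \<open>d > 0\<close> by simp
    ultimately show ?thesis
      using schwarz_pick_pos[of "\<lambda>z. N z + \<i> * of_real d" w a] w a by simp
  qed
  then have "eventually (\<lambda>d. (cmod (N w - N a))\<^sup>2 * (Im w * Im a)
      \<le> (cmod (w - a))\<^sup>2 * ((Im (N w) + d) * (Im (N a) + d))) (at_right 0)"
    by (intro eventually_at_right_less[THEN eventually_mono]) auto
  moreover have "((\<lambda>d. (cmod (w - a))\<^sup>2 * ((Im (N w) + d) * (Im (N a) + d)))
      \<longlongrightarrow> (cmod (w - a))\<^sup>2 * ((Im (N w) + 0) * (Im (N a) + 0))) (at_right 0)"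
    by (intro tendsto_intros)
  ultimately show ?thesis
    using tendsto_lowerbound[of _ "(cmod (w - a))\<^sup>2 * ((Im (N w) + 0) * (Im (N a) + 0))" "at_right (0::real)"] by simp
qed

text \<open>The inequality on \<open>Im (N z)\<close> is weak because point masses give real
  constants. The limit along the axis rules out a linear term at infinity, which corresponds to
  total mass one of the measure.\<close>

definition sublinear_pick :: "(complex \<Rightarrow> complex) \<Rightarrow> bool" where
  "sublinear_pick N \<longleftrightarrow> N holomorphic_on uhp \<and> (\<forall>z\<in>uhp. Im (N z) \<ge> 0) \<and>
     ((\<lambda>y. N (\<i> * of_real y) / of_real y) \<longlongrightarrow> 0) at_top"

lemma sublinear_pickD:
  assumes "sublinear_pick N"
  shows "N holomorphic_on uhp" "Im z > 0 \<Longrightarrow> Im (N z) \<ge> 0"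
    "((\<lambda>y. N (\<i> * of_real y) / of_real y) \<longlongrightarrow> 0) at_top"
  using assms by (auto simp: sublinear_pick_def)

lemma sublinear_pick_axis_le:
  assumes "sublinear_pick N" "e > 0"
  shows "eventually (\<lambda>y. cmod (N (\<i> * of_real y)) \<le> e * y) at_top"
  using tendstoD[OF sublinear_pickD(3)[OF assms(1)] assms(2)] eventually_gt_at_top[of 0]
proof eventually_elim
  case (elim y)
  then show ?case by (simp add: norm_divide field_simps)
qed

lemma sublinear_pick_schwarz:
  assumes "sublinear_pick N" "Im w > 0" "Im a > 0"
  shows "(cmod (N w - N a))\<^sup>2 * (Im w * Im a) \<le> (cmod (w - a))\<^sup>2 * (Im (N w) * Im (N a))"
  using schwarz_pick[OF sublinear_pickD(1,2)[OF assms(1)]] assms(2,3) by blast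

text \<open>Schwarz--Pick compares \<open>z\<close> with the point of the imaginary axis at the same
  height. Their distance is |Re z|, at most \<alpha> times the height, so smallness on the axis
  spreads to the cone.\<close>

lemma sublinear_pick_cone_le:
  assumes N: "sublinear_pick N" and e: "e > 0"
  shows "\<exists>\<beta>>0. \<forall>z\<in>truncated_cone \<alpha> \<beta>. cmod (N z) \<le> e * Im z"
proof -
  \<comment> \<open>With u = |N z|, v = |N(iy)| and v \<le> d y, Schwarz--Pick yields (u - v)^2
    \<le> \<alpha>^2 u d y, hence u^2 \<le> u (2 + \<alpha>^2) d y. This \<open>d\<close> turns the
    factor into e.\<close>
  define d where "d = e / (2 + \<alpha>\<^sup>2)"
  have d: "d > 0" "(2 + \<alpha>\<^sup>2) * d = e" using e by (simp_all add: d_def add_pos_nonneg)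
     (metis add_pos_nonneg less_irrefl nonzero_mult_div_cancel_left times_divide_eq_right zero_le_power2 zero_less_numeral)
  obtain Y where Y: "\<And>y. y \<ge> Y \<Longrightarrow> cmod (N (\<i> * of_real y)) \<le> d * y"
    using sublinear_pick_axis_le[OF N d(1)] by (auto simp: eventually_at_top_linorder)
  show ?thesis
  proof (intro exI[of _ "max Y 1"] conjI ballI)
    fix z assume z: "z \<in> truncated_cone \<alpha> (max Y 1)"
    define y where "y = Im z"
    have y: "y > 0" "y \<ge> Y" "\<bar>Re z\<bar> \<le> \<alpha> * y" using z by (auto simp: truncated_cone_def y_def)
    define u where "u = cmod (N z)"
    define v where "v = cmod (N (\<i> * of_real y))"
    have v: "v \<le> d * y" using Y y by (simp add: v_def)
    have "(cmod (N z - N (\<i> * of_real y)))\<^sup>2 * (y * y) \<le> (cmod (z - \<i> * of_real y))\<^sup>2 * (Im (N z) * Im (N (\<i> * of_real y)))"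
      using sublinear_pick_schwarz[OF N, of z "\<i> * of_real y"] y by (simp add: y_def)
    also have "(cmod (z - \<i> * of_real y))\<^sup>2 = (Re z)\<^sup>2" by (simp add: cmod_power2 y_def)
    also have "(Re z)\<^sup>2 * (Im (N z) * Im (N (\<i> * of_real y))) \<le> (\<alpha> * y)\<^sup>2 * (u * (d * y))"
    proof (intro mult_mono)
      show "(Re z)\<^sup>2 \<le> (\<alpha> * y)\<^sup>2" using y(3) by (simp add: abs_le_square_iff[symmetric])
      show "Im (N z) \<le> u" unfolding u_def using abs_Im_le_cmod[of "N z"] by linarith
      show "Im (N (\<i> * of_real y)) \<le> d * y" using v abs_Im_le_cmod[of "N (\<i> * of_real y)"] unfolding v_def by linarith
    qed (use sublinear_pickD(2)[OF N] y d(1) in \<open>auto simp: u_def y_def\<close>)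
    finally have 1: "(cmod (N z - N (\<i> * of_real y)))\<^sup>2 * (y * y) \<le> (\<alpha>\<^sup>2 * u * d * y) * (y * y)"
      by (simp add: power2_eq_square algebra_simps)
    have "(u - v)\<^sup>2 \<le> (cmod (N z - N (\<i> * of_real y)))\<^sup>2"
      unfolding u_def v_def using norm_triangle_ineq3[of "N z" "N (\<i> * of_real y)"]
      by (simp add: abs_le_square_iff[symmetric])
    also have "\<dots> \<le> \<alpha>\<^sup>2 * u * d * y" using 1 y(1) by simp
    finally have "u * u \<le> 2 * (u * v) + \<alpha>\<^sup>2 * u * d * y - v\<^sup>2"
      by (simp add: power2_eq_square algebra_simps)
    also have "\<dots> \<le> 2 * (u * (d * y)) + \<alpha>\<^sup>2 * u * d * y"
    proof -
      have "u * v \<le> u * (d * y)" using v by (intro mult_left_mono) (auto simp: u_def)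
      then show ?thesis using zero_le_power2[of v] by linarith
    qed
    also have "\<dots> = u * (((2 + \<alpha>\<^sup>2) * d) * y)" by (simp add: algebra_simps)
    finally have 2: "u * u \<le> u * (e * y)" unfolding d(2) .
    have "u \<le> e * y"
    proof (cases "u = 0")
      case True then show ?thesis using e y by simp
    next
      case False
      then have "u > 0" by (simp add: u_def)
      then show ?thesis using 2 by simp
    qed
    then show "cmod (N z) \<le> e * Im z" by (simp add: u_def y_def)
  qed auto
qed

section \<open>Inverting the shift of the identity by a Pick function\<close>

text \<open>Both points have \<open>c * Im (N w) < Im w\<close>, because their common image lies in
  the half-plane. Schwarz--Pick then makes \<open>c * N\<close> strictly shorten the distance
  between them, against w - w' = c (N w - N w').\<close>

lemma pick_shift_inj:
  assumes N: "sublinear_pick N" and c: "c \<ge> 0" and w: "Im w > 0" and w': "Im w' > 0"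
    and eq: "w - of_real c * N w = w' - of_real c * N w'" and pos: "Im (w - of_real c * N w) > 0"
  shows "w = w'"
proof (rule ccontr)
  assume ne: "w \<noteq> w'"
  have "c \<noteq> 0" using eq ne by auto
  then have c: "c > 0" using c by simp
  define p q where "p = Im (N w)" "q = Im (N w')"
  have p: "p \<ge> 0" "q \<ge> 0" using sublinear_pickD(2)[OF N] w w' by (auto simp: p_q_def)
  have "Im (w' - of_real c * N w') > 0" using pos unfolding eq .
  then have cp: "c * p < Im w" "c * q < Im w'" using pos by (simp_all add: p_q_def)
  have "w - w' = of_real c * (N w - N w')" using eq by (simp add: algebra_simps)
  then have "(cmod (w - w'))\<^sup>2 = c\<^sup>2 * (cmod (N w - N w'))\<^sup>2"
    using c by (simp add: norm_mult power_mult_distrib)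
  then have "(cmod (w - w'))\<^sup>2 * (Im w * Im w') = c\<^sup>2 * ((cmod (N w - N w'))\<^sup>2 * (Im w * Im w'))"
    by simp
  also have "\<dots> \<le> c\<^sup>2 * ((cmod (w - w'))\<^sup>2 * (p * q))"
    using sublinear_pick_schwarz[OF N w w'] by (intro mult_left_mono) (auto simp: p_q_def)
  also have "\<dots> = (cmod (w - w'))\<^sup>2 * ((c * p) * (c * q))" by (simp add: power2_eq_square)
  also have "(c * p) * (c * q) < Im w * Im w'"
    using cp p c w w' by (intro mult_strict_mono) auto
  then have "(cmod (w - w'))\<^sup>2 * ((c * p) * (c * q)) < (cmod (w - w'))\<^sup>2 * (Im w * Im w')"
    using ne by (intro mult_strict_left_mono) auto
  finally show False by simp
qed

text \<open>
  An a priori bound: a solution satisfies \<open>s * Im (N w) \<le> Im w\<close>, which makes the Schwarz--Pick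
  inequality between \<open>w\<close> and a point far up the imaginary axis a contraction estimate.
\<close>

lemma pick_fixed_point_bound:
  assumes N: "sublinear_pick N" and s: "s \<ge> 0" and z: "Im z > 0" and w: "Im w > 0"
    and eq: "w = z + of_real s * N w"
    and Y: "Y > 0" and d: "d \<ge> 0" and dY: "s * Im (N (\<i> * of_real Y)) \<le> d\<^sup>2 * Y"
  shows "cmod (w - z) * (1 - d) \<le> s * cmod (N (\<i> * of_real Y)) + d * cmod (z - \<i> * of_real Y)"
proof -
  define b where "b = \<i> * complex_of_real Y"
  have sN: "s * Im (N w) \<le> Im w" using arg_cong[OF eq, of Im] z by simp
  have "(s * cmod (N w - N b))\<^sup>2 * (Im w * Y) = s\<^sup>2 * ((cmod (N w - N b))\<^sup>2 * (Im w * Im b))"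
    by (simp add: b_def power_mult_distrib)
  also have "\<dots> \<le> s\<^sup>2 * ((cmod (w - b))\<^sup>2 * (Im (N w) * Im (N b)))"
    using sublinear_pick_schwarz[OF N w, of b] Y by (intro mult_left_mono) (auto simp: b_def)
  also have "\<dots> = (cmod (w - b))\<^sup>2 * ((s * Im (N w)) * (s * Im (N b)))"
    by (simp add: power2_eq_square)
  also have "\<dots> \<le> (cmod (w - b))\<^sup>2 * (Im w * (d\<^sup>2 * Y))"
  proof (rule mult_left_mono)
    show "(s * Im (N w)) * (s * Im (N b)) \<le> Im w * (d\<^sup>2 * Y)"
      by (rule mult_mono) (use sN dY w s sublinear_pickD(2)[OF N, of b] Y in \<open>auto simp: b_def\<close>)
  qed simp
  also have "\<dots> = (d * cmod (w - b))\<^sup>2 * (Im w * Y)" by (simp add: power_mult_distrib)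
  finally have "(s * cmod (N w - N b))\<^sup>2 \<le> (d * cmod (w - b))\<^sup>2" using w Y by simp
  then have 1: "s * cmod (N w - N b) \<le> d * cmod (w - b)"
    using d by (auto intro: power2_le_imp_le)
  have "w - z = of_real s * N w" using eq by (simp add: algebra_simps)
  then have "cmod (w - z) = s * cmod (N w)" using s by (simp add: norm_mult)
  also have "\<dots> \<le> s * (cmod (N b) + cmod (N w - N b))"
    using s norm_triangle_sub[of "N w" "N b"] by (intro mult_left_mono) auto
  also have "\<dots> \<le> s * cmod (N b) + d * cmod (w - b)" using 1 by (simp add: distrib_left)
  also have "d * cmod (w - b) \<le> d * (cmod (w - z) + cmod (z - b))"
    using d norm_triangle_ineq[of "w - z" "z - b"] by (intro mult_left_mono) auto
  finally show ?thesis by (simp add: b_def algebra_simps)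
qed

text \<open>The equation is the fixed point problem w = z + c N(w). Its right side preserves the
  half-plane above \<open>Im z\<close>, but no bounded subset is evidently preserved. The a priori
  bound replaces compactness, provided that it holds uniformly for all coefficients s between 0 and
  c.\<close>

lemma pick_shift_surj:
  assumes N: "sublinear_pick N" and c: "c \<ge> 0" and z: "Im z > 0"
  shows "\<exists>w. Im w > 0 \<and> w - of_real c * N w = z"
proof (cases "c = 0")
  case True then show ?thesis using z by auto
next
  case False
  then have c: "c > 0" using c by simp
  \<comment> \<open>The constant 1/(4c) gives c Im N(iY) \<le> Y/4, which is the hypothesis of the a
    priori bound for d = 1/2.\<close>
  have "eventually (\<lambda>y. y > 0 \<and> cmod (N (\<i> * of_real y)) \<le> (1 / (4 * c)) * y) at_top"
    using sublinear_pick_axis_le[OF N, of "1 / (4 * c)"] c by (intro eventually_conj eventually_gt_at_top) auto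
  then obtain Y where Y: "Y > 0" "cmod (N (\<i> * of_real Y)) \<le> (1 / (4 * c)) * Y"
    unfolding eventually_at_top_linorder by blast
  define b where "b = \<i> * complex_of_real Y"
  \<comment> \<open>Twice the right side of the a priori bound at d = 1/2; the added 1 makes the
    inequality strict.\<close>
  define R where "R = 2 * (c * cmod (N b) + (1/2) * cmod (z - b)) + 1"
  have R: "R > 0" unfolding R_def using c by (intro add_nonneg_pos) auto
  have bound: "cmod (w - z) < R" if w: "Im w > 0" "w = z + of_real s * N w" and s: "0 \<le> s" "s \<le> c" for w s
  proof -
    have "s * Im (N b) \<le> c * Im (N b)"
      using sublinear_pickD(2)[OF N, of b] Y s by (intro mult_right_mono) (auto simp: b_def)
    also have "\<dots> \<le> c * ((1 / (4 * c)) * Y)"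
      using Y c abs_Im_le_cmod[of "N b"] by (intro mult_left_mono) (auto simp: b_def)
    also have "\<dots> = (1/2)\<^sup>2 * Y" using c by (simp add: power2_eq_square)
    finally have "s * Im (N b) \<le> (1/2)\<^sup>2 * Y" .
    then have "cmod (w - z) * (1 - 1/2) \<le> s * cmod (N b) + (1/2) * cmod (z - b)"
      using pick_fixed_point_bound[OF N s(1) z w Y(1), of "1/2"] by (simp add: b_def)
    moreover have "s * cmod (N b) \<le> c * cmod (N b)" using s by (intro mult_right_mono) auto
    ultimately show ?thesis unfolding R_def by simp
  qed
  \<comment> \<open>Brouwer applies to \<open>g\<close>, where the scaling \<open>m\<close> keeps the displacement in a ball;
    the bound on fixed points then forces \<open>m w = 1\<close>\<close>
  define m where "m w = R / max R (cmod (of_real c * N w))" for w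
  have m: "m w > 0" "m w \<le> 1" for w using R by (auto simp: m_def)
  define g where "g w = z + of_real (m w) * (of_real c * N w)" for w
  define K where "K = {w. Im w \<ge> Im z} \<inter> cball z R"
  have K_uhp: "K \<subseteq> uhp" using z by (auto simp: K_def)
  have "compact K" unfolding K_def by (intro closed_Int_compact closed_halfspace_Im_ge compact_cball)
  moreover have "convex K" unfolding K_def by (intro convex_Int convex_halfspace_Im_ge convex_cball)
  moreover have "K \<noteq> {}" using R by (auto simp: K_def intro!: exI[of _ z])
  moreover have "continuous_on K g"
  proof -
    have "continuous_on K N"
      using sublinear_pickD(1)[OF N] K_uhp by (meson continuous_on_subset holomorphic_on_imp_continuous_on)
    then show ?thesis
      unfolding g_def m_def using R by (intro continuous_intros) auto
  qed
  moreover have "g \<in> K \<rightarrow> K"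
  proof
    fix w assume w: "w \<in> K"
    have "Im (N w) \<ge> 0" using sublinear_pickD(2)[OF N] K_uhp w by auto
    then have "Im (g w) \<ge> Im z" using m(1)[of w] c by (simp add: g_def)
    moreover have "cmod (of_real (m w) * (of_real c * N w)) \<le> R"
    proof -
      have "cmod (of_real (m w) * (of_real c * N w)) = m w * cmod (of_real c * N w)"
        using m(1)[of w] by (simp add: norm_mult)
      also have "\<dots> \<le> m w * max R (cmod (of_real c * N w))" using m(1)[of w] by (intro mult_left_mono) auto
      also have "\<dots> = R" using R by (simp add: m_def)
      finally show ?thesis .
    qed
    ultimately show "g w \<in> K" by (simp add: K_def g_def dist_norm)
  qed
  ultimately obtain w where w: "w \<in> K" "g w = w" by (rule brouwer)
  have eq: "w = z + of_real (m w * c) * N w" using w(2) by (simp add: g_def mult.assoc)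
  have Imw: "Im w > 0" using w K_uhp by auto
  have "cmod (w - z) < R"
    using bound[OF Imw eq] m[of w] c by (simp add: mult_le_cancel_right1)
  then have lt: "m w * cmod (of_real c * N w) < R"
    using arg_cong[OF eq, of "\<lambda>x. cmod (x - z)"] m(1)[of w] by (simp add: norm_mult)
  have "m w = 1"
  proof (rule ccontr)
    assume "m w \<noteq> 1"
    \<comment> \<open>If the truncation is active, the displacement has length exactly R,
      contradicting the strict bound.\<close>
    then have "R < cmod (of_real c * N w)" using R by (auto simp: m_def max_def split: if_splits)
    then have "m w * cmod (of_real c * N w) = R" using R by (auto simp: m_def max_def)
    then show False using lt by simp
  qed
  then show ?thesis using eq Imw by (intro exI[of _ w]) (simp add: algebra_simps)
qed

text \<open>Meaningful for \<open>c \<ge> 0\<close> and \<open>z\<close> in the upper half-plane; arbitrary elsewhere.\<close>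

definition pick_shift_inv :: "(complex \<Rightarrow> complex) \<Rightarrow> real \<Rightarrow> complex \<Rightarrow> complex" where
  "pick_shift_inv N c z = (THE w. Im w > 0 \<and> w - of_real c * N w = z)"

lemma pick_shift_inv_eqI:
  assumes "sublinear_pick N" "c \<ge> 0" "Im w > 0" "w - of_real c * N w = z" "Im z > 0"
  shows "pick_shift_inv N c z = w"
  unfolding pick_shift_inv_def
proof (rule the_equality)
  show "Im w > 0 \<and> w - of_real c * N w = z" using assms by simp
  fix w' assume w': "Im w' > 0 \<and> w' - of_real c * N w' = z"
  show "w' = w"
    by (rule pick_shift_inj[OF assms(1,2)]) (use assms w' in auto)
qed

lemma pick_shift_inv:
  assumes "sublinear_pick N" "c \<ge> 0" "Im z > 0"
  shows "Im (pick_shift_inv N c z) > 0"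
    and "pick_shift_inv N c z - of_real c * N (pick_shift_inv N c z) = z"
proof -
  obtain w where w: "Im w > 0" "w - of_real c * N w = z"
    using pick_shift_surj[OF assms] by blast
  have "pick_shift_inv N c z = w" by (rule pick_shift_inv_eqI) (use assms w in auto)
  then show "Im (pick_shift_inv N c z) > 0"
    "pick_shift_inv N c z - of_real c * N (pick_shift_inv N c z) = z" using w by auto
qed

text \<open>On the open set \<open>D\<close> of points that the shift sends into the half-plane it
  is injective, so it has a holomorphic inverse on its image. Surjectivity makes that image cover
  the half-plane.\<close>

lemma pick_shift_inv_holomorphic:
  assumes N: "sublinear_pick N" and c: "c \<ge> 0"
  shows "pick_shift_inv N c holomorphic_on uhp"
proof -
  define h where "h w = w - of_real c * N w" for w
  define D where "D = {w \<in> uhp. h w \<in> uhp}"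
  have hhol: "h holomorphic_on uhp"
    unfolding h_def by (intro holomorphic_intros sublinear_pickD(1)[OF N])
  have "D = uhp \<inter> h -` uhp" by (auto simp: D_def)
  then have "open D"
    using continuous_open_preimage[OF holomorphic_on_imp_continuous_on[OF hhol] open_uhp open_uhp] by simp
  moreover have "h holomorphic_on D" using hhol by (rule holomorphic_on_subset) (auto simp: D_def)
  moreover have "inj_on h D"
    by (rule inj_onI) (auto simp: D_def h_def intro: pick_shift_inj[OF N c])
  ultimately obtain g where g: "g holomorphic_on (h ` D)" "\<And>z. z \<in> D \<Longrightarrow> g (h z) = z"
    by (metis holomorphic_has_inverse)
  have *: "z \<in> h ` D \<and> g z = pick_shift_inv N c z" if "z \<in> uhp" for z
  proof -
    let ?w = "pick_shift_inv N c z"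
    have w: "Im ?w > 0" "h ?w = z" using pick_shift_inv[OF N c, of z] that by (auto simp: h_def)
    then have "?w \<in> D" using that by (simp add: D_def)
    then show ?thesis using g(2)[of ?w] w by (metis image_eqI)
  qed
  have "g holomorphic_on uhp" using g(1) by (rule holomorphic_on_subset) (use * in auto)
  then show ?thesis by (rule holomorphic_transform) (use * in auto)
qed

text \<open>The delicate clause is the limit along the axis, since the shift inverse moves iy off
  the axis. The a priori bound controls \<open>N\<close> at the moved point by twice its size at iy.
  For c > 0 the factor c can be cancelled there, so c = 0 is treated apart.\<close>

lemma sublinear_pick_compose_shift_inv:
  assumes N: "sublinear_pick N" and c: "c \<ge> 0"
  shows "sublinear_pick (\<lambda>z. N (pick_shift_inv N c z))"
proof (cases "c = 0")
  case True
  have eq: "pick_shift_inv N c z = z" if "Im z > 0" for z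
    using pick_shift_inv(2)[OF N c that] True by simp
  show ?thesis
    unfolding sublinear_pick_def
  proof (intro conjI ballI)
    show "(\<lambda>z. N (pick_shift_inv N c z)) holomorphic_on uhp"
      using sublinear_pickD(1)[OF N] by (rule holomorphic_transform) (auto simp: eq)
    show "Im (N (pick_shift_inv N c z)) \<ge> 0" if "z \<in> uhp" for z
      using sublinear_pickD(2)[OF N] eq that by auto
    show "((\<lambda>y. N (pick_shift_inv N c (\<i> * of_real y)) / of_real y) \<longlongrightarrow> 0) at_top"
      by (rule Lim_transform_eventually[OF sublinear_pickD(3)[OF N]])
         (use eventually_gt_at_top[of 0] in eventually_elim, simp add: eq)
  qed
next
  case False
  then have c0: "c > 0" using c by simp
  show ?thesis
    unfolding sublinear_pick_def
  proof (intro conjI ballI)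
    have "pick_shift_inv N c ` uhp \<subseteq> uhp" using pick_shift_inv(1)[OF N c] by auto
    then show "(\<lambda>z. N (pick_shift_inv N c z)) holomorphic_on uhp"
      using holomorphic_on_compose_gen[OF pick_shift_inv_holomorphic[OF N c] sublinear_pickD(1)[OF N]]
      by (simp add: o_def)
    show "Im (N (pick_shift_inv N c z)) \<ge> 0" if "z \<in> uhp" for z
      using sublinear_pickD(2)[OF N] pick_shift_inv(1)[OF N c] that by auto
    show "((\<lambda>y. N (pick_shift_inv N c (\<i> * of_real y)) / of_real y) \<longlongrightarrow> 0) at_top"
    proof (rule Lim_null_comparison)
      have "1 / (4 * c) > 0" using c0 by simp
      from sublinear_pick_axis_le[OF N this] eventually_gt_at_top[of 0]
      show "eventually (\<lambda>y. norm (N (pick_shift_inv N c (\<i> * of_real y)) / of_real y)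
              \<le> 2 * cmod (N (\<i> * of_real y) / of_real y)) at_top"
      proof eventually_elim
        case (elim y)
        define z where "z = \<i> * complex_of_real y"
        define w where "w = pick_shift_inv N c z"
        have z: "Im z > 0" using elim c0 by (simp add: z_def)
        have w: "Im w > 0" "w = z + of_real c * N w"
          using pick_shift_inv[OF N c z] by (simp_all add: w_def algebra_simps)
        have "c * Im (N z) \<le> c * ((1 / (4 * c)) * y)"
          using elim c0 abs_Im_le_cmod[of "N z"] by (intro mult_left_mono) (auto simp: z_def)
        also have "\<dots> = (1/2)\<^sup>2 * y" using c0 by (simp add: power2_eq_square)
        \<comment> \<open>The comparison point on the axis is taken to be \<open>z\<close> itself,
          so the second term of the bound vanishes.\<close>
        finally have "cmod (w - z) * (1 - 1/2) \<le> c * cmod (N z)"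
          using pick_fixed_point_bound[OF N c z w, of y "1/2"] elim c0 by (simp add: z_def)
        moreover have "w - z = of_real c * N w" using w(2) by (simp add: algebra_simps)
        then have "cmod (w - z) = c * cmod (N w)" using c0 by (simp add: norm_mult)
        ultimately have "c * cmod (N w) \<le> c * (2 * cmod (N z))" by simp
        then have "cmod (N w) \<le> 2 * cmod (N z)" using c0 by simp
        then show ?case using elim c0 by (simp add: w_def z_def norm_divide divide_right_mono)
      qed
      show "((\<lambda>y. 2 * cmod (N (\<i> * of_real y) / of_real y)) \<longlongrightarrow> 0) at_top"
        using tendsto_norm_zero[OF sublinear_pickD(3)[OF N]] by (rule tendsto_mult_right_zero)
    qed
  qed
qed

section \<open>The Cauchy transform of a probability measure\<close>

lemma norm_cauchy_kernel_le:
  assumes "Im z > 0"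
  shows "cmod (1 / (z - of_real s)) \<le> 1 / Im z" and "cmod (z - of_real s) \<ge> Im z" and "z \<noteq> of_real s"
proof -
  show 1: "cmod (z - of_real s) \<ge> Im z"
    using abs_Im_le_cmod[of "z - of_real s"] by simp
  show "cmod (1 / (z - of_real s)) \<le> 1 / Im z"
    unfolding norm_divide using assms 1 by (simp add: frac_le)
  show "z \<noteq> of_real s" using assms by auto
qed

context real_distribution
begin

lemma integrable_cauchy_kernel:
  assumes "Im z > 0"
  shows "integrable M (\<lambda>s. 1 / (z - complex_of_real s))"
  by (rule integrable_const_bound[where B = "1 / Im z"])
     (use norm_cauchy_kernel_le(1)[OF assms] in auto)

lemma integrable_inverse_square_kernel:
  assumes "Im z > 0"
  shows "integrable M (\<lambda>s. 1 / (cmod (z - of_real s))\<^sup>2)"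
proof (rule integrable_const_bound[where B = "1 / (Im z)\<^sup>2"])
  show "AE s in M. norm (1 / (cmod (z - of_real s))\<^sup>2) \<le> 1 / (Im z)\<^sup>2"
    using norm_cauchy_kernel_le(2)[OF assms] assms by (intro AE_I2) (auto intro!: frac_le power_mono)
qed simp

text \<open>For |w - z| < y/2 the error of the difference quotient of the kernel is (w - z) / ((w -
  s)(z - s)^2), of modulus at most 2 |w - z| / y^3 uniformly in s. Integration keeps this
  bound.\<close>

lemma has_field_derivative_cauchy_transform:
  assumes z: "Im z > 0"
  shows "(cauchy_transform M has_field_derivative (LINT s|M. - 1 / (z - complex_of_real s)\<^sup>2)) (at z)"
proof -
  let ?D = "LINT s|M. - 1 / (z - complex_of_real s)\<^sup>2"
  define y where "y = Im z"
  have y: "y > 0" using z by (simp add: y_def)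
  have D: "integrable M (\<lambda>s. - 1 / (z - complex_of_real s)\<^sup>2)"
  proof (rule integrable_const_bound[where B = "1 / (Im z)\<^sup>2"])
    show "AE s in M. norm (- 1 / (z - complex_of_real s)\<^sup>2) \<le> 1 / (Im z)\<^sup>2"
      using norm_cauchy_kernel_le(2)[OF z] z
      by (intro AE_I2) (auto simp: norm_divide norm_power intro!: frac_le power_mono)
  qed simp
  have "((\<lambda>w. (cauchy_transform M w - cauchy_transform M z) / (w - z) - ?D) \<longlongrightarrow> 0) (at z)"
  proof (rule Lim_null_comparison)
    have "eventually (\<lambda>w. w \<in> ball z (y / 2) \<and> w \<noteq> z) (at z)"
      using y by (intro eventually_conj eventually_at_ball eventually_at_in_open') (auto simp: eventually_at_filter)
    then show "eventually (\<lambda>w. norm ((cauchy_transform M w - cauchy_transform M z) / (w - z) - ?D)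
        \<le> cmod (w - z) * (2 / y ^ 3)) (at z)"
    proof eventually_elim
      case (elim w)
      have "Im (z - w) \<le> cmod (z - w)" using abs_Im_le_cmod[of "z - w"] by simp
      then have w: "Im w \<ge> y / 2" "w \<noteq> z" using elim by (auto simp: dist_norm y_def)
      then have w0: "Im w > 0" using y by simp
      have eq: "(1 / (w - of_real s) - 1 / (z - of_real s)) / (w - z) - - 1 / (z - complex_of_real s)\<^sup>2
          = (w - z) / ((w - of_real s) * (z - of_real s)\<^sup>2)" for s :: real
        using norm_cauchy_kernel_le(3)[OF w0, of s] norm_cauchy_kernel_le(3)[OF z, of s] w(2)
        by (simp add: divide_simps) (simp add: power2_eq_square algebra_simps)
      have bound: "cmod ((w - z) / ((w - of_real s) * (z - of_real s)\<^sup>2)) \<le> cmod (w - z) * (2 / y ^ 3)" for s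
      proof -
        have "(y / 2) * y\<^sup>2 \<le> cmod (w - of_real s) * (cmod (z - of_real s))\<^sup>2"
          using norm_cauchy_kernel_le(2)[OF w0, of s] norm_cauchy_kernel_le(2)[OF z, of s] w y
          by (intro mult_mono power_mono) (auto simp: y_def)
        then have "cmod (w - z) / (cmod (w - of_real s) * (cmod (z - of_real s))\<^sup>2) \<le> cmod (w - z) / ((y / 2) * y\<^sup>2)"
          using y norm_cauchy_kernel_le(3)[OF w0, of s] norm_cauchy_kernel_le(3)[OF z, of s]
          by (intro divide_left_mono mult_pos_pos) auto
        also have "\<dots> = cmod (w - z) * (2 / y ^ 3)"
          using y by (simp add: power2_eq_square power3_eq_cube)
        finally show ?thesis by (simp add: norm_divide norm_mult norm_power)
      qed
      have "(cauchy_transform M w - cauchy_transform M z) / (w - z) - ?D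
          = (LINT s|M. (1 / (w - of_real s) - 1 / (z - of_real s)) / (w - z) - - 1 / (z - complex_of_real s)\<^sup>2)"
        using integrable_cauchy_kernel[OF w0] integrable_cauchy_kernel[OF z] D
        unfolding cauchy_transform_def by (subst Bochner_Integration.integral_diff) auto
      also have "\<dots> = (LINT s|M. (w - z) / ((w - of_real s) * (z - of_real s)\<^sup>2))"
        unfolding eq ..
      also have "cmod \<dots> \<le> (LINT s|M. cmod ((w - z) / ((w - of_real s) * (z - of_real s)\<^sup>2)))"
        by (rule integral_norm_bound)
      also have "\<dots> \<le> (LINT s|M. cmod (w - z) * (2 / y ^ 3))"
        using bound y by (intro integral_mono') auto
      also have "\<dots> = cmod (w - z) * (2 / y ^ 3)" using prob_space by simp
      finally show ?case .
    qed
    have "((\<lambda>w. cmod (w - z) * (2 / y ^ 3)) \<longlongrightarrow> cmod (z - z) * (2 / y ^ 3)) (at z)"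
      by (intro tendsto_intros)
    then show "((\<lambda>w. cmod (w - z) * (2 / y ^ 3)) \<longlongrightarrow> 0) (at z)" by simp
  qed
  then show ?thesis unfolding has_field_derivative_iff by (rule LIM_zero_cancel)
qed

lemma cauchy_transform_holomorphic: "cauchy_transform M holomorphic_on uhp"
  using has_field_derivative_cauchy_transform
  by (auto simp: holomorphic_on_open[OF open_uhp])

lemma Im_cauchy_transform:
  assumes z: "Im z > 0"
  shows "Im (cauchy_transform M z) = - (Im z * (LINT s|M. 1 / (cmod (z - of_real s))\<^sup>2))"
proof -
  have "Im (1 / (z - of_real s)) = - Im z * (1 / (cmod (z - of_real s))\<^sup>2)" for s
    unfolding Im_divide cmod_power2 by simp
  then have "Im (cauchy_transform M z) = (LINT s|M. - Im z * (1 / (cmod (z - of_real s))\<^sup>2))"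
    unfolding cauchy_transform_def integral_Im[OF integrable_cauchy_kernel[OF z], symmetric] by simp
  also have "\<dots> = - Im z * (LINT s|M. 1 / (cmod (z - of_real s))\<^sup>2)"
    by (rule integral_mult_right_zero)
  finally show ?thesis by simp
qed

lemma Im_cauchy_transform_neg:
  assumes z: "Im z > 0"
  shows "Im (cauchy_transform M z) < 0"
proof -
  have "0 < (LINT s|M. 1 / (cmod (z - of_real s))\<^sup>2)"
    using integrable_inverse_square_kernel[OF z] norm_cauchy_kernel_le(3)[OF z]
    by (intro expectation_greater AE_I2) auto
  then show ?thesis unfolding Im_cauchy_transform[OF z] using z by simp
qed

lemma cauchy_transform_nonzero: "Im z > 0 \<Longrightarrow> cauchy_transform M z \<noteq> 0"
  using Im_cauchy_transform_neg[of z] by auto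

text \<open>Nonnegative variance of |1 / (z - s)| gives |G|^2 \<le> a, where a is the integral of 1
  / |z - s|^2. As Im G = - a Im z, the imaginary part of 1/G is a Im z / |G|^2.\<close>

lemma Im_reciprocal_cauchy_ge:
  assumes z: "Im z > 0"
  shows "Im (reciprocal_cauchy M z) \<ge> Im z"
proof -
  define a where "a = (LINT s|M. 1 / (cmod (z - of_real s))\<^sup>2)"
  define b where "b = (LINT s|M. cmod (1 / (z - of_real s)))"
  let ?X = "\<lambda>s. cmod (1 / (z - complex_of_real s))"
  have sq: "(?X s)\<^sup>2 = 1 / (cmod (z - of_real s))\<^sup>2" for s by (simp add: norm_divide power_divide)
  have "integrable M ?X" using integrable_cauchy_kernel[OF z] by (rule integrable_norm)
  then have "0 \<le> a - b\<^sup>2"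
    using variance_eq[of ?X] variance_positive[of ?X] integrable_inverse_square_kernel[OF z]
    unfolding sq a_def b_def by simp
  moreover have "cmod (cauchy_transform M z) \<le> b"
    unfolding cauchy_transform_def b_def by (rule integral_norm_bound)
  then have "(cmod (cauchy_transform M z))\<^sup>2 \<le> b\<^sup>2" by (rule power_mono) simp
  ultimately have le: "(cmod (cauchy_transform M z))\<^sup>2 \<le> a" by simp
  have "Im z \<le> Im z * a / (cmod (cauchy_transform M z))\<^sup>2"
    using le z cauchy_transform_nonzero[OF z] by (simp add: le_divide_eq)
  also have "\<dots> = Im (reciprocal_cauchy M z)"
    unfolding reciprocal_cauchy_def Im_divide cmod_power2 Im_cauchy_transform[OF z] a_def by simp
  finally show ?thesis .
qed

text \<open>The integrands iy / (iy - s) are bounded by 1 and tend to 1, so the limit is the total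
  mass.\<close>

lemma cauchy_transform_axis:
  "((\<lambda>y. \<i> * of_real y * cauchy_transform M (\<i> * of_real y)) \<longlongrightarrow> 1) at_top"
proof -
  have "((\<lambda>y. LINT s|M. \<i> * of_real y * (1 / (\<i> * of_real y - of_real s))) \<longlongrightarrow> (LINT s|M. 1)) at_top"
  proof (rule integral_dominated_convergence_at_top[where w = "\<lambda>_. 1"])
    show "eventually (\<lambda>y. AE s in M. norm (\<i> * of_real y * (1 / (\<i> * of_real y - complex_of_real s))) \<le> 1) at_top"
      using eventually_gt_at_top[of 0]
    proof eventually_elim
      case (elim y)
      have "norm (\<i> * of_real y * (1 / (\<i> * of_real y - complex_of_real s))) \<le> 1" for s
        using norm_cauchy_kernel_le(2)[of "\<i> * of_real y" s] elim by (auto simp: norm_mult norm_divide divide_le_eq_1)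
      then show ?case by simp
    qed
    have "((\<lambda>y. \<i> * of_real y * (1 / (\<i> * of_real y - complex_of_real s))) \<longlongrightarrow> 1) at_top" for s
    proof -
      have "((\<lambda>y. 1 / (1 - (of_real s / \<i>) * complex_of_real (inverse y))) \<longlongrightarrow> 1 / (1 - (of_real s / \<i>) * complex_of_real 0)) at_top"
        by (intro tendsto_intros tendsto_inverse_0_at_top filterlim_ident) auto
      then have "((\<lambda>y. 1 / (1 - (of_real s / \<i>) * complex_of_real (inverse y))) \<longlongrightarrow> 1) at_top" by simp
      moreover have "eventually (\<lambda>y. 1 / (1 - (of_real s / \<i>) * complex_of_real (inverse y))
          = \<i> * of_real y * (1 / (\<i> * of_real y - complex_of_real s))) at_top"
        using eventually_gt_at_top[of 0]
      proof eventually_elim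
        case (elim y)
        have "1 - (of_real s / \<i>) * complex_of_real (inverse y) = (\<i> * of_real y - of_real s) / (\<i> * of_real y)"
          using elim by (simp add: field_simps)
        then show ?case by simp
      qed
      ultimately show ?thesis by (rule Lim_transform_eventually)
    qed
    then show "AE s in M. ((\<lambda>y. \<i> * of_real y * (1 / (\<i> * of_real y - complex_of_real s))) \<longlongrightarrow> 1) at_top"
      by simp
  qed auto
  then show ?thesis
    unfolding cauchy_transform_def integral_mult_right_zero using prob_space by simp
qed

lemma sublinear_pick_reciprocal_cauchy:
  "sublinear_pick (\<lambda>z. reciprocal_cauchy M z - z)"
  unfolding sublinear_pick_def
proof (intro conjI ballI)
  show "(\<lambda>z. reciprocal_cauchy M z - z) holomorphic_on uhp"
    unfolding reciprocal_cauchy_def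
    by (intro holomorphic_intros cauchy_transform_holomorphic) (use cauchy_transform_nonzero in auto)
  show "0 \<le> Im (reciprocal_cauchy M z - z)" if "z \<in> uhp" for z
    using Im_reciprocal_cauchy_ge[of z] that by simp
  have "((\<lambda>y. \<i> / (\<i> * of_real y * cauchy_transform M (\<i> * of_real y)) - \<i>) \<longlongrightarrow> \<i> / 1 - \<i>) at_top"
    by (intro tendsto_intros cauchy_transform_axis) auto
  then have "((\<lambda>y. \<i> / (\<i> * of_real y * cauchy_transform M (\<i> * of_real y)) - \<i>) \<longlongrightarrow> 0) at_top" by simp
  moreover have "eventually (\<lambda>y. \<i> / (\<i> * of_real y * cauchy_transform M (\<i> * of_real y)) - \<i>
      = (reciprocal_cauchy M (\<i> * of_real y) - \<i> * of_real y) / of_real y) at_top"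
    using eventually_gt_at_top[of 0]
    by eventually_elim (simp add: reciprocal_cauchy_def cauchy_transform_nonzero field_simps)
  ultimately show "((\<lambda>y. (reciprocal_cauchy M (\<i> * of_real y) - \<i> * of_real y) / of_real y) \<longlongrightarrow> 0) at_top"
    by (rule Lim_transform_eventually)
qed

end

section \<open>The Cauchy transform determines the measure\<close>

text \<open>The density of the centred Cauchy distribution of scale \<open>y\<close>. It serves
  twice: as an approximate identity in the uniqueness proof, and as the Poisson kernel of the
  half-plane in the existence proof.\<close>

definition poisson_kernel :: "real \<Rightarrow> real \<Rightarrow> real" where
  "poisson_kernel y x = y / (pi * (x\<^sup>2 + y\<^sup>2))"

lemma poisson_kernel_pos: "y > 0 \<Longrightarrow> poisson_kernel y x > 0"
  by (simp add: poisson_kernel_def add_nonneg_pos)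

lemma poisson_kernel_measurable [measurable]: "poisson_kernel y \<in> borel_measurable borel"
  unfolding poisson_kernel_def by measurable

lemma poisson_kernel_scale:
  assumes "y > 0" shows "y * poisson_kernel y (y * u) = poisson_kernel 1 u"
proof -
  have "pi * ((y * u)\<^sup>2 + y\<^sup>2) = y\<^sup>2 * (pi * (u\<^sup>2 + 1))" by (simp add: power2_eq_square algebra_simps)
  then show ?thesis using assms by (simp add: poisson_kernel_def power2_eq_square)
qed

lemma has_bochner_integral_poisson_kernel_1: "has_bochner_integral lborel (poisson_kernel 1) 1"
proof -
  have i: "integrable lborel (\<lambda>x::real. inverse (1 + x\<^sup>2))"
    using integrable_inverse_1_plus_square by (simp add: set_integrable_def)
  have "(LBINT x. inverse (1 + x\<^sup>2)) = pi"
    using LBINT_inverse_1_plus_square by (simp add: interval_lebesgue_integral_def set_lebesgue_integral_def)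
  then have "has_bochner_integral lborel (\<lambda>x::real. inverse (1 + x\<^sup>2)) pi"
    using i by (simp add: has_bochner_integral_iff)
  then have "has_bochner_integral lborel (\<lambda>x::real. (1 / pi) * inverse (1 + x\<^sup>2)) ((1 / pi) * pi)"
    by (intro has_bochner_integral_mult_right)
  moreover have "(1 / pi) * inverse (1 + x\<^sup>2) = poisson_kernel 1 x" for x
    by (simp add: poisson_kernel_def field_simps)
  ultimately show ?thesis by simp
qed

lemma has_bochner_integral_poisson_kernel:
  assumes "y > 0"
  shows "has_bochner_integral lborel (\<lambda>x. poisson_kernel y (x - a)) 1"
proof -
  have "has_bochner_integral lborel (\<lambda>x. (1 / y) * poisson_kernel 1 x) ((1 / y) * 1)"
    by (intro has_bochner_integral_mult_right has_bochner_integral_poisson_kernel_1)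
  moreover have "(1 / y) * poisson_kernel 1 x = poisson_kernel y (a + y * x - a)" for x
    using poisson_kernel_scale[OF assms, of x] assms by (simp add: field_simps)
  ultimately have "has_bochner_integral lborel (\<lambda>x. poisson_kernel y (a + y * x - a)) (1 /\<^sub>R \<bar>y\<bar>)"
    using assms by (simp add: divide_inverse)
  then show ?thesis using lborel_has_bochner_integral_real_affine_iff[of y "\<lambda>x. poisson_kernel y (x - a)" 1 a] assms
    by (simp add: divide_inverse)
qed

text \<open>The substitution x = y u fixes the kernel at scale 1 and moves y into the exponential,
  which tends to 1. The purpose is that this factor is nonzero for small y and can be
  cancelled.\<close>

lemma tendsto_poisson_kernel_char:
  "((\<lambda>y. LINT x|lborel. iexp (t * x) * complex_of_real (poisson_kernel y x)) \<longlongrightarrow> 1) (at_right 0)"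
proof -
  have int: "integrable lborel (\<lambda>u. iexp c * complex_of_real (poisson_kernel 1 u))" for c
    using has_bochner_integral_poisson_kernel_1 by (auto simp: has_bochner_integral_iff)
  \<comment> \<open>The parameter is inverted because the dominated convergence rule applied here
    takes limits at infinity.\<close>
  have "((\<lambda>y. LINT u|lborel. iexp (t * (inverse y * u)) * complex_of_real (poisson_kernel 1 u))
      \<longlongrightarrow> (LINT u|lborel. complex_of_real (poisson_kernel 1 u))) at_top"
  proof (rule integral_dominated_convergence_at_top[where w = "poisson_kernel 1"])
    show "AE x in lborel. ((\<lambda>y. iexp (t * (inverse y * x)) * complex_of_real (poisson_kernel 1 x))
        \<longlongrightarrow> complex_of_real (poisson_kernel 1 x)) at_top"
    proof (rule AE_I2)
      fix x :: real
      have "((\<lambda>y. iexp (t * (inverse y * x)) * complex_of_real (poisson_kernel 1 x))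
        \<longlongrightarrow> iexp (t * (0 * x)) * complex_of_real (poisson_kernel 1 x)) at_top"
        by (intro tendsto_intros tendsto_inverse_0_at_top filterlim_ident)
      then show "((\<lambda>y. iexp (t * (inverse y * x)) * complex_of_real (poisson_kernel 1 x))
        \<longlongrightarrow> complex_of_real (poisson_kernel 1 x)) at_top" by simp
    qed
    show "eventually (\<lambda>y. AE x in lborel. norm (iexp (t * (inverse y * x)) * complex_of_real (poisson_kernel 1 x))
        \<le> poisson_kernel 1 x) at_top"
      by (intro always_eventually allI AE_I2) (simp add: norm_mult poisson_kernel_pos less_imp_le)
    show "integrable lborel (poisson_kernel 1)"
      using has_bochner_integral_poisson_kernel_1 by (auto simp: has_bochner_integral_iff)
  qed auto
  moreover have "(LINT u|lborel. complex_of_real (poisson_kernel 1 u)) = 1"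
    using has_bochner_integral_poisson_kernel_1 by (auto simp: has_bochner_integral_iff)
  ultimately have "((\<lambda>y. LINT u|lborel. iexp (t * (y * u)) * complex_of_real (poisson_kernel 1 u)) \<longlongrightarrow> 1) (at_right 0)"
    by (simp add: filterlim_at_right_to_top inverse_eq_divide)
  moreover have "eventually (\<lambda>y. (LINT u|lborel. iexp (t * (y * u)) * complex_of_real (poisson_kernel 1 u))
      = (LINT x|lborel. iexp (t * x) * complex_of_real (poisson_kernel y x))) (at_right 0)"
    using eventually_at_right_less[of 0]
  proof eventually_elim
    case (elim y)
    have "(LINT x|lborel. iexp (t * x) * complex_of_real (poisson_kernel y x))
        = y *\<^sub>R (LINT u|lborel. iexp (t * (0 + y * u)) * complex_of_real (poisson_kernel y (0 + y * u)))"
      using lborel_integral_real_affine[of y "\<lambda>x. iexp (t * x) * complex_of_real (poisson_kernel y x)" 0] elim by simp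
    also have "\<dots> = (LINT u|lborel. y *\<^sub>R (iexp (t * (0 + y * u)) * complex_of_real (poisson_kernel y (0 + y * u))))"
      by simp
    also have "\<dots> = (LINT u|lborel. iexp (t * (y * u)) * complex_of_real (poisson_kernel 1 u))"
      by (intro Bochner_Integration.integral_cong)
         (auto simp: poisson_kernel_scale[OF elim, symmetric] scaleR_conv_of_real)
    finally show ?case ..
  qed
  ultimately show ?thesis by (rule Lim_transform_eventually)
qed

text \<open>
  Both sides are the characteristic function of the convolution of \<open>M\<close> with a Cauchy
  distribution.
\<close>

lemma (in real_distribution) char_times_poisson_kernel:
  assumes y: "y > 0"
  shows "char M t * (LINT x|lborel. iexp (t * x) * complex_of_real (poisson_kernel y x))
    = (LINT x|lborel. iexp (t * x) * complex_of_real (- Im (cauchy_transform M (Complex x y)) / pi))"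
proof -
  interpret pair_sigma_finite M lborel ..
  \<comment> \<open>Integrating over x first separates the two characteristic functions by
    translation; integrating over s first produces the Poisson integral of \<open>M\<close>, that
    is, - Im G / pi at height y.\<close>
  let ?f = "\<lambda>s x. iexp (t * x) * complex_of_real (poisson_kernel y (x - s))"
  have P: "integrable lborel (\<lambda>x. poisson_kernel y (x - s))" "(LINT x|lborel. poisson_kernel y (x - s)) = 1" for s
    using has_bochner_integral_poisson_kernel[OF y, of s] by (auto simp: has_bochner_integral_iff)
  have nf: "norm (?f s x) = poisson_kernel y (x - s)" for s x
    by (simp add: norm_mult poisson_kernel_pos[OF y] less_imp_le)
  have int: "integrable lborel (?f s)" for s
  proof (rule Bochner_Integration.integrable_bound[OF P(1)[of s]])
    show "AE x in lborel. norm (?f s x) \<le> norm (poisson_kernel y (x - s))"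
      unfolding nf by simp
  qed measurable
  have "integrable (M \<Otimes>\<^sub>M lborel) (\<lambda>(s, x). ?f s x)"
  proof (rule Fubini_integrable)
    show "integrable M (\<lambda>s. LINT x|lborel. norm (case (s, x) of (s, x) \<Rightarrow> ?f s x))"
      by (simp only: case_prod_conv nf P(2)) simp
    show "AE s in M. integrable lborel (\<lambda>x. case (s, x) of (s, x) \<Rightarrow> ?f s x)"
      using int by simp
  qed measurable
  then have swap: "(LINT x|lborel. LINT s|M. ?f s x) = (LINT s|M. LINT x|lborel. ?f s x)"
    by (rule Fubini_integral)
  have inner_x: "(LINT x|lborel. ?f s x) = iexp (t * s) * (LINT x|lborel. iexp (t * x) * complex_of_real (poisson_kernel y x))" for s
  proof -
    have "(LINT x|lborel. ?f s x) = (LINT x|lborel. ?f s (s + 1 * x))"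
      using lborel_integral_real_affine[of 1 "?f s" s] by simp
    also have "\<dots> = (LINT x|lborel. iexp (t * s) * (iexp (t * x) * complex_of_real (poisson_kernel y x)))"
      by (intro Bochner_Integration.integral_cong) (auto simp: distrib_left exp_add)
    finally show ?thesis by simp
  qed
  have outer_s: "(LINT s|M. iexp (t * s) * (LINT x|lborel. iexp (t * x) * complex_of_real (poisson_kernel y x)))
      = char M t * (LINT x|lborel. iexp (t * x) * complex_of_real (poisson_kernel y x))"
    by (simp add: char_def)
  have inner_s: "(\<lambda>x. LINT s|M. ?f s x) = (\<lambda>x. iexp (t * x) * complex_of_real (- Im (cauchy_transform M (Complex x y)) / pi))"
  proof
    fix x
    have "poisson_kernel y (x - s) = (y / pi) * (1 / (cmod (Complex x y - of_real s))\<^sup>2)" for s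
      unfolding cmod_power2 by (simp add: poisson_kernel_def)
    then have "(LINT s|M. poisson_kernel y (x - s)) = (y / pi) * (LINT s|M. 1 / (cmod (Complex x y - of_real s))\<^sup>2)"
      unfolding integral_mult_right_zero[symmetric] by simp
    then have "(LINT s|M. poisson_kernel y (x - s)) = - Im (cauchy_transform M (Complex x y)) / pi"
      using Im_cauchy_transform[of "Complex x y"] y by simp
    then show "(LINT s|M. ?f s x) = iexp (t * x) * complex_of_real (- Im (cauchy_transform M (Complex x y)) / pi)"
      by simp
  qed
  show ?thesis using swap unfolding inner_x outer_s inner_s by (rule sym)
qed

text \<open>Equal Cauchy transforms give equal characteristic functions after smoothing by a Cauchy
  distribution. For small y the smoothing factor is nonzero, so it cancels and Levy's theorem
  applies.\<close>

theorem cauchy_transform_unique: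
  assumes M: "real_distribution M" and M': "real_distribution M'"
    and eq: "\<And>z. Im z > 0 \<Longrightarrow> cauchy_transform M z = cauchy_transform M' z"
  shows "M = M'"
proof (rule Levy_uniqueness[OF M M'], rule ext)
  fix t
  have "eventually (\<lambda>y. (LINT x|lborel. iexp (t * x) * complex_of_real (poisson_kernel y x)) \<noteq> 0) (at_right 0)"
    using tendsto_poisson_kernel_char by (rule tendsto_imp_eventually_ne) simp
  then have "eventually (\<lambda>y. (LINT x|lborel. iexp (t * x) * complex_of_real (poisson_kernel y x)) \<noteq> 0 \<and> y > 0) (at_right 0)"
    using eventually_at_right_less[of 0] by (rule eventually_conj)
  then obtain y where y: "y > 0" "(LINT x|lborel. iexp (t * x) * complex_of_real (poisson_kernel y x)) \<noteq> 0"
    using eventually_happens[of _ "at_right (0::real)"] by auto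
  have G: "cauchy_transform M (Complex x y) = cauchy_transform M' (Complex x y)" for x
    using eq y(1) by simp
  have "char M t * (LINT x|lborel. iexp (t * x) * complex_of_real (poisson_kernel y x))
      = char M' t * (LINT x|lborel. iexp (t * x) * complex_of_real (poisson_kernel y x))"
    unfolding real_distribution.char_times_poisson_kernel[OF M y(1)]
      real_distribution.char_times_poisson_kernel[OF M' y(1)] G ..
  then show "char M t = char M' t" using y(2) mult_right_cancel by blast
qed

section \<open>Functions that are reciprocal Cauchy transforms\<close>

text \<open>Since f is bounded, (f(\<zeta>) - f(z)) / ((\<zeta> - z)(\<zeta> - cnj z)) decays like
  |\<zeta>|^-2, so the slanted sides of large triangles contribute nothing in the limit. The Poisson
  kernel has mass 1, so the subtracted constant integrates to f(z). Holomorphy below the real axis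
  lets the contour run along it.\<close>

lemma poisson_formula:
  assumes hol: "f holomorphic_on {\<zeta>. Im \<zeta> > - \<eta>}" and \<eta>: "\<eta> > 0"
    and bound: "\<And>\<zeta>. Im \<zeta> \<ge> 0 \<Longrightarrow> cmod (f \<zeta>) \<le> B" and z: "Im z > 0"
  shows "has_bochner_integral lborel
    (\<lambda>x. f (of_real x) * complex_of_real (poisson_kernel (Im z) (x - Re z))) (f z)"
proof -
  define y where "y = Im z"
  have y: "y > 0" using z by (simp add: y_def)
  define P where "P x = poisson_kernel y (x - Re z)" for x
  have P: "has_bochner_integral lborel P 1" "\<And>x. P x > 0"
    using has_bochner_integral_poisson_kernel[OF y] poisson_kernel_pos[OF y] by (auto simp: P_def[abs_def])
  have Pm [measurable]: "P \<in> borel_measurable borel" unfolding P_def[abs_def] by measurable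
  have B: "B \<ge> 0" using bound[OF less_imp_le[OF z]] norm_ge_zero order_trans by blast
  \<comment> \<open>\<open>S\<close> stays above both the edge of the domain of \<open>f\<close> and
    the second pole \<open>cnj z\<close>, which has height -y.\<close>
  define S where "S = {\<zeta>. Im \<zeta> > - min \<eta> y}"
  have S: "open S" "convex S" "z \<in> S" "S \<subseteq> {\<zeta>. Im \<zeta> > - \<eta>}" "{\<zeta>. Im \<zeta> \<ge> 0} \<subseteq> S"
    using y \<eta> by (auto simp: S_def open_halfspace_Im_gt convex_halfspace_Im_gt y_def)
  have cz: "\<zeta> - cnj z \<noteq> 0" if "\<zeta> \<in> S" for \<zeta>
  proof
    assume "\<zeta> - cnj z = 0" then have "Im \<zeta> = - y" by (simp add: y_def complex_eq_iff)
    then show False using that by (auto simp: S_def)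
  qed
  \<comment> \<open>Subtracting \<open>f z\<close> removes the pole at \<open>z\<close>; Cauchy's theorem is applied on the triangle
    with vertices \<open>-R\<close>, \<open>R\<close>, \<open>iR\<close>\<close>
  define q where "q \<zeta> = (if \<zeta> = z then deriv f z else (f \<zeta> - f z) / (\<zeta> - z)) * (2 * \<i> * of_real y / (\<zeta> - cnj z))" for \<zeta>
  have fS: "f holomorphic_on S" using hol S(4) by (rule holomorphic_on_subset)
  have qhol: "q holomorphic_on S"
    unfolding q_def using S cz
    by (intro holomorphic_on_mult pole_lemma[OF fS] holomorphic_intros) (auto simp: interior_open)
  define Q where "Q x = 2 * pi * \<i> * (f (of_real x) - f z) * complex_of_real (P x)" for x :: real
  have fcont: "continuous_on UNIV (\<lambda>x::real. f (of_real x))"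
    by (rule continuous_on_compose2[OF holomorphic_on_imp_continuous_on[OF hol]])
       (use \<eta> in \<open>auto intro!: continuous_intros\<close>)
  have fm [measurable]: "(\<lambda>x::real. f (of_real x)) \<in> borel_measurable borel"
    using fcont by (rule borel_measurable_continuous_onI)
  \<comment> \<open>On the real line (x - z)(x - cnj z) = |x - z|^2, so the second factor combines
    with the denominator into the Poisson kernel.\<close>
  have qQ: "q (of_real x) = Q x" for x
  proof -
    have ne: "complex_of_real x - z \<noteq> 0" "complex_of_real x - cnj z \<noteq> 0"
      using z by (auto simp: complex_eq_iff)
    have "(complex_of_real x - z) * (of_real x - cnj z) = of_real ((x - Re z)\<^sup>2 + y\<^sup>2)"
      by (simp add: complex_eq_iff y_def power2_eq_square algebra_simps)
    moreover have "q (of_real x) = (f (of_real x) - f z) / (of_real x - z) * (2 * \<i> * of_real y / (of_real x - cnj z))"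
      using ne by (simp add: q_def)
    ultimately have "q (of_real x) = (f (of_real x) - f z) * (2 * \<i> * of_real y) / of_real ((x - Re z)\<^sup>2 + y\<^sup>2)"
      by (simp only: times_divide_times_eq)
    also have "\<dots> = Q x"
      unfolding Q_def P_def poisson_kernel_def of_real_divide of_real_mult[of pi] by simp
    finally show ?thesis .
  qed
  have fP: "integrable lborel (\<lambda>x. f (of_real x) * complex_of_real (P x))"
  proof (rule Bochner_Integration.integrable_bound)
    show "integrable lborel (\<lambda>x. B * P x)" using P(1) by (auto simp: has_bochner_integral_iff)
    show "AE x in lborel. norm (f (of_real x) * complex_of_real (P x)) \<le> norm (B * P x)"
      using bound B P(2) by (intro AE_I2) (auto simp: norm_mult abs_mult intro!: mult_mono)
  qed measurable
  have Qeq: "Q x = 2 * pi * \<i> * (f (of_real x) * complex_of_real (P x)) - 2 * pi * \<i> * f z * complex_of_real (P x)" for x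
    by (simp add: Q_def algebra_simps)
  have Qint: "integrable lborel Q"
    unfolding Qeq using fP P(1) by (auto simp: has_bochner_integral_iff)
  \<comment> \<open>On a slanted side |\<zeta>| \<ge> R/2 and |z| \<le> R/4, so both denominators
    are at least R/4. With numerators 2B and 2y this gives 64 B y / R^2, and each of the two sides
    has length at most 2R.\<close>
  define K where "K = 256 * B * y"
  have est: "cmod (LINT x|lborel. indicator {-R..R} x *\<^sub>R Q x) \<le> K / R" if R: "R > 0" "R \<ge> 4 * cmod z" for R
  proof -
    define a b c where "a = complex_of_real (- R)" "b = complex_of_real R" "c = \<i> * complex_of_real R"
    have qle: "cmod (q \<zeta>) \<le> 64 * B * y / R\<^sup>2" if "Im \<zeta> \<ge> 0" "\<bar>Re \<zeta>\<bar> + Im \<zeta> = R" for \<zeta>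
    proof -
      have "R / 2 \<le> cmod \<zeta>"
        using abs_Re_le_cmod[of \<zeta>] abs_Im_le_cmod[of \<zeta>] that by linarith
      then have d: "R / 4 \<le> cmod (\<zeta> - z)" "R / 4 \<le> cmod (\<zeta> - cnj z)"
        using R norm_triangle_ineq2[of \<zeta> z] norm_triangle_ineq2[of \<zeta> "cnj z"] by auto
      then have ne: "\<zeta> \<noteq> z" using R by auto
      have "cmod (f \<zeta> - f z) \<le> 2 * B"
        using norm_triangle_ineq4[of "f \<zeta>" "f z"] bound[OF that(1)] bound[of z] z by linarith
      then have "cmod ((f \<zeta> - f z) / (\<zeta> - z)) \<le> 2 * B / (R / 4)"
        unfolding norm_divide using d R B by (intro frac_le) auto
      moreover have "cmod (2 * \<i> * of_real y / (\<zeta> - cnj z)) \<le> 2 * y / (R / 4)"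
        unfolding norm_divide using d R y by (intro frac_le) (auto simp: norm_mult)
      ultimately have "cmod ((f \<zeta> - f z) / (\<zeta> - z)) * cmod (2 * \<i> * of_real y / (\<zeta> - cnj z))
          \<le> 2 * B / (R / 4) * (2 * y / (R / 4))"
        using R B by (intro mult_mono) auto
      then have "cmod (q \<zeta>) \<le> 2 * B / (R / 4) * (2 * y / (R / 4))"
      proof -
        have "q \<zeta> = (f \<zeta> - f z) / (\<zeta> - z) * (2 * \<i> * of_real y / (\<zeta> - cnj z))"
          using ne by (simp add: q_def)
        then show ?thesis
          using \<open>cmod ((f \<zeta> - f z) / (\<zeta> - z)) * _ \<le> _\<close> by (simp only: norm_mult)
      qed
      also have "\<dots> = 64 * B * y / R\<^sup>2" by (simp add: power2_eq_square)
      finally show ?thesis .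
    qed
    have abc: "a \<in> S" "b \<in> S" "c \<in> S" using S(5) R by (auto simp: a_b_c_def)
    then have "convex hull {a, b, c} \<subseteq> S" using S(2) by (intro hull_minimal) auto
    then have "(q has_contour_integral 0) (linepath a b +++ linepath b c +++ linepath c a)"
      by (intro Cauchy_theorem_triangle holomorphic_on_subset[OF qhol])
    from has_chain_integral_chain_integral3[OF this]
    have sum0: "contour_integral (linepath a b) q = - (contour_integral (linepath b c) q + contour_integral (linepath c a) q)"
      by (simp add: add_eq_0_iff add.assoc)
    have qi: "q contour_integrable_on linepath u v" if "u \<in> S" "v \<in> S" for u v
      by (intro contour_integrable_continuous_linepath continuous_on_subset[OF holomorphic_on_imp_continuous_on[OF qhol]]
          closed_segment_subset that S(2))
    have M: "0 \<le> 64 * B * y / R\<^sup>2" using B y by simp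
    have bc: "cmod (contour_integral (linepath b c) q) \<le> 64 * B * y / R\<^sup>2 * cmod (c - b)"
    proof (rule contour_integral_bound_linepath[OF qi M])
      fix \<zeta> assume "\<zeta> \<in> closed_segment b c"
      then obtain u where "0 \<le> u" "u \<le> 1" "\<zeta> = (1 - u) *\<^sub>R b + u *\<^sub>R c" by (auto simp: closed_segment_def)
      then have "Re \<zeta> = (1 - u) * R" "Im \<zeta> = u * R" "(1 - u) * R \<ge> 0" "u * R \<ge> 0"
        using R by (auto simp: a_b_c_def)
      then show "cmod (q \<zeta>) \<le> 64 * B * y / R\<^sup>2" by (intro qle) (auto simp: algebra_simps)
    qed (use abc in auto)
    have ca: "cmod (contour_integral (linepath c a) q) \<le> 64 * B * y / R\<^sup>2 * cmod (a - c)"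
    proof (rule contour_integral_bound_linepath[OF qi M])
      fix \<zeta> assume "\<zeta> \<in> closed_segment c a"
      then obtain u where "0 \<le> u" "u \<le> 1" "\<zeta> = (1 - u) *\<^sub>R c + u *\<^sub>R a" by (auto simp: closed_segment_def)
      then have "Re \<zeta> = - (u * R)" "Im \<zeta> = (1 - u) * R" "(1 - u) * R \<ge> 0" "u * R \<ge> 0"
        using R by (auto simp: a_b_c_def)
      then show "cmod (q \<zeta>) \<le> 64 * B * y / R\<^sup>2" by (intro qle) (auto simp: algebra_simps)
    qed (use abc in auto)
    have "cmod (c - b) \<le> 2 * R" "cmod (a - c) \<le> 2 * R"
      using norm_triangle_ineq4[of c b] norm_triangle_ineq4[of a c] R by (auto simp: a_b_c_def norm_mult)
    then have le: "64 * B * y / R\<^sup>2 * cmod (c - b) \<le> 64 * B * y / R\<^sup>2 * (2 * R)"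
      "64 * B * y / R\<^sup>2 * cmod (a - c) \<le> 64 * B * y / R\<^sup>2 * (2 * R)"
      using M by (auto intro!: mult_left_mono simp del: times_divide_eq_left)
    have "cmod (contour_integral (linepath b c) q) + cmod (contour_integral (linepath c a) q)
       \<le> 2 * (64 * B * y / R\<^sup>2 * (2 * R))"
      unfolding mult_2[of "64 * B * y / R\<^sup>2 * (2 * R)"]
      by (rule add_mono[OF order_trans[OF bc le(1)] order_trans[OF ca le(2)]])
    also have "\<dots> = K / R" using R by (simp add: K_def power2_eq_square)
    finally have "cmod (contour_integral (linepath a b) q) \<le> K / R"
      unfolding sum0 norm_minus_cancel using norm_triangle_ineq order_trans by blast
    moreover have "contour_integral (linepath a b) q = (LINT x|lborel. indicator {-R..R} x *\<^sub>R Q x)"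
    proof -
      have "set_integrable lborel {-R..R} Q"
        unfolding set_integrable_def using Qint by (intro integrable_mult_indicator) auto
      then have "(LINT x:{-R..R}|lborel. Q x) = integral {-R..R} Q"
        by (rule set_borel_integral_eq_integral)
      moreover have "contour_integral (linepath a b) q = integral {Re a..Re b} (\<lambda>x. q (of_real x))"
        using R by (intro contour_integral_linepath_Reals_eq) (auto simp: a_b_c_def)
      ultimately show ?thesis by (simp add: qQ set_lebesgue_integral_def a_b_c_def)
    qed
    ultimately show ?thesis by simp
  qed
  have "((\<lambda>R. LINT x|lborel. indicator {-R..R} x *\<^sub>R Q x) \<longlongrightarrow> (LINT x|lborel. Q x)) at_top"
  proof (rule integral_dominated_convergence_at_top[where w = "\<lambda>x. norm (Q x)"])
    show "AE x in lborel. ((\<lambda>R. indicator {-R..R} x *\<^sub>R Q x) \<longlongrightarrow> Q x) at_top"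
    proof (rule AE_I2)
      fix x :: real
      have "eventually (\<lambda>R. indicator {-R..R} x *\<^sub>R Q x = Q x) at_top"
        using eventually_ge_at_top[of "\<bar>x\<bar>"] by eventually_elim (auto simp: indicator_def)
      then show "((\<lambda>R. indicator {-R..R} x *\<^sub>R Q x) \<longlongrightarrow> Q x) at_top" by (rule tendsto_eventually)
    qed
    show "eventually (\<lambda>R. AE x in lborel. norm (indicator {-R..R} x *\<^sub>R Q x) \<le> norm (Q x)) at_top"
      by (intro always_eventually allI AE_I2) (auto simp: indicator_def)
  qed (use Qint in \<open>auto intro: integrable_norm borel_measurable_integrable\<close>)
  moreover have "((\<lambda>R. LINT x|lborel. indicator {-R..R} x *\<^sub>R Q x) \<longlongrightarrow> 0) at_top"
  proof (rule Lim_null_comparison)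
    show "eventually (\<lambda>R. cmod (LINT x|lborel. indicator {-R..R} x *\<^sub>R Q x) \<le> K / R) at_top"
      using eventually_gt_at_top[of 0] eventually_ge_at_top[of "4 * cmod z"] by eventually_elim (rule est)
    show "((\<lambda>R. K / R) \<longlongrightarrow> 0) at_top" by (rule tendsto_divide_0[OF tendsto_const filterlim_at_top_imp_at_infinity[OF filterlim_ident]])
  qed
  ultimately have "(LINT x|lborel. Q x) = 0" by (rule tendsto_unique[rotated]) simp
  moreover have "(LINT x|lborel. Q x) = 2 * pi * \<i> * (LINT x|lborel. f (of_real x) * complex_of_real (P x)) - 2 * pi * \<i> * f z"
    unfolding Qeq using fP P(1) by (subst Bochner_Integration.integral_diff) (auto simp: has_bochner_integral_iff)
  ultimately have "(LINT x|lborel. f (of_real x) * complex_of_real (P x)) = f z" by simp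
  then show ?thesis using fP by (simp add: has_bochner_integral_iff P_def y_def)
qed

lemma (in real_distribution) norm_cauchy_transform_le:
  assumes z: "Im z > 0"
  shows "cmod (cauchy_transform M z) \<le> 1 / Im z"
proof -
  have "cmod (cauchy_transform M z) \<le> (LINT s|M. cmod (1 / (z - of_real s)))"
    unfolding cauchy_transform_def by (rule integral_norm_bound)
  also have "\<dots> \<le> (LINT s|M. 1 / Im z)"
    using norm_cauchy_kernel_le(1)[OF z] z by (intro integral_mono') auto
  also have "\<dots> = 1 / Im z" using prob_space by simp
  finally show ?thesis .
qed

text \<open>After the shift, g is bounded and continuous up to the real line, so its boundary values
  yield a density. The Poisson formula shows that the Cauchy transform of this density has the right
  imaginary part; the remaining real difference is constant by Schwarz--Pick and vanishes by decay
  along the axis.\<close>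

lemma exists_cauchy_transform_shift:
  assumes hol: "g holomorphic_on uhp" and bound: "\<And>z. Im z > 0 \<Longrightarrow> cmod (g z) \<le> 1 / Im z"
    and neg: "\<And>z. Im z > 0 \<Longrightarrow> Im (g z) \<le> 0"
    and axis: "((\<lambda>y. \<i> * of_real y * g (\<i> * of_real y)) \<longlongrightarrow> 1) at_top" and \<eta>: "\<eta> > 0"
  shows "\<exists>\<rho>. real_distribution \<rho> \<and> (\<forall>z\<in>uhp. cauchy_transform \<rho> z = g (z + \<i> * of_real \<eta>))"
proof -
  define f where "f \<zeta> = g (\<zeta> + \<i> * of_real \<eta>)" for \<zeta>
  have fhol: "f holomorphic_on {\<zeta>. Im \<zeta> > - \<eta>}"
  proof -
    have "(\<lambda>\<zeta>. \<zeta> + \<i> * of_real \<eta>) holomorphic_on {\<zeta>. Im \<zeta> > - \<eta>}" by (intro holomorphic_intros)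
    moreover have "(\<lambda>\<zeta>. \<zeta> + \<i> * of_real \<eta>) ` {\<zeta>. Im \<zeta> > - \<eta>} \<subseteq> uhp" by auto
    ultimately show ?thesis
      using holomorphic_on_compose_gen[OF _ hol] unfolding f_def by (simp add: o_def)
  qed
  have fb: "cmod (f \<zeta>) \<le> 1 / (Im \<zeta> + \<eta>)" if "Im \<zeta> \<ge> 0" for \<zeta>
    using bound[of "\<zeta> + \<i> * of_real \<eta>"] that \<eta> by (simp add: f_def)
  have fB: "cmod (f \<zeta>) \<le> 1 / \<eta>" if "Im \<zeta> \<ge> 0" for \<zeta>
    using fb[OF that] that \<eta> by (elim order_trans) (auto intro!: frac_le)
  \<comment> \<open>Stieltjes inversion gives the density\<close>
  define p where "p x = - Im (f (complex_of_real x)) / pi" for x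
  have p0: "p x \<ge> 0" for x
    unfolding p_def f_def using neg[of "of_real x + \<i> * of_real \<eta>"] \<eta> by (intro divide_nonneg_pos) auto
  have fcont: "continuous_on UNIV (\<lambda>x::real. f (of_real x))"
    by (rule continuous_on_compose2[OF holomorphic_on_imp_continuous_on[OF fhol]])
       (use \<eta> in \<open>auto intro!: continuous_intros\<close>)
  have pm [measurable]: "p \<in> borel_measurable borel"
    unfolding p_def[abs_def] by (intro borel_measurable_continuous_onI continuous_intros fcont) auto
  have pois: "has_bochner_integral lborel (\<lambda>x. p x * poisson_kernel (Im z) (x - Re z)) (- Im (f z) / pi)"
    if z: "Im z > 0" for z
  proof -
    have "has_bochner_integral lborel (\<lambda>x. (- 1 / pi) * Im (f (of_real x) * complex_of_real (poisson_kernel (Im z) (x - Re z))))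
        ((- 1 / pi) * Im (f z))"
      by (intro has_bochner_integral_mult_right has_bochner_integral_Im poisson_formula[OF fhol \<eta> fB z])
    then show ?thesis by (simp add: p_def[abs_def])
  qed
  have mass: "integrable lborel p" "(LINT x|lborel. p x) = 1"
  proof -
    \<comment> \<open>Up to the factor pi y this is the Poisson integrand at iy with y = n + 1. The
      weight y^2 / (x^2 + y^2) increases to 1, so monotone convergence obtains the mass of
      \<open>p\<close> from the behaviour of f on the axis.\<close>
    define F where "F n x = pi * real (Suc n) * (p x * poisson_kernel (real (Suc n)) x)" for n x
    have Feq: "F n x = p x * ((real (Suc n))\<^sup>2 / (x\<^sup>2 + (real (Suc n))\<^sup>2))" for n x
      by (simp add: F_def poisson_kernel_def power2_eq_square)
    have F: "has_bochner_integral lborel (F n) (- real (Suc n) * Im (f (\<i> * of_real (real (Suc n)))))" for n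
    proof -
      have "has_bochner_integral lborel (F n) (pi * real (Suc n) * (- Im (f (\<i> * of_real (real (Suc n)))) / pi))"
        unfolding F_def using pois[of "\<i> * of_real (real (Suc n))"]
        by (intro has_bochner_integral_mult_right) simp
      then show ?thesis by (simp del: of_nat_Suc)
    qed
    have 1: "mono (\<lambda>n. F n x)" for x
    proof (rule monoI)
      fix m n :: nat assume "m \<le> n"
      then have le: "(real (Suc m))\<^sup>2 \<le> (real (Suc n))\<^sup>2" by (intro power_mono) auto
      have *: "a / (x\<^sup>2 + a) = 1 - x\<^sup>2 / (x\<^sup>2 + a)" if "a > 0" for a
      proof -
        have "x\<^sup>2 + a > 0" using that by (intro add_nonneg_pos) auto
        then show ?thesis by (simp add: field_simps)
      qed
      have "x\<^sup>2 / (x\<^sup>2 + (real (Suc n))\<^sup>2) \<le> x\<^sup>2 / (x\<^sup>2 + (real (Suc m))\<^sup>2)"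
        using le by (intro divide_left_mono) (auto intro!: mult_pos_pos add_nonneg_pos)
      then show "F m x \<le> F n x"
        unfolding Feq using p0 by (intro mult_left_mono) (auto simp: * simp del: of_nat_Suc)
    qed
    have 2: "F n x \<ge> 0" for n x unfolding Feq using p0 by simp
    have 3: "(\<lambda>n. F n x) \<longlonglongrightarrow> p x" for x
    proof -
      have "(\<lambda>n. x\<^sup>2 * (inverse (real (Suc n)))\<^sup>2 + 1) \<longlonglongrightarrow> x\<^sup>2 * 0\<^sup>2 + 1"
        by (intro tendsto_intros LIMSEQ_inverse_real_of_nat)
      then have "(\<lambda>n. p x * (1 / (x\<^sup>2 * (inverse (real (Suc n)))\<^sup>2 + 1))) \<longlonglongrightarrow> p x * (1 / (x\<^sup>2 * 0\<^sup>2 + 1))"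
        by (intro tendsto_intros LIMSEQ_inverse_real_of_nat) auto
      moreover have "p x * (1 / (x\<^sup>2 * (inverse (real (Suc n)))\<^sup>2 + 1)) = F n x" for n
      proof -
        have "x\<^sup>2 * (inverse (real (Suc n)))\<^sup>2 + 1 = (x\<^sup>2 + (real (Suc n))\<^sup>2) / (real (Suc n))\<^sup>2"
          by (simp add: divide_simps)
        then show ?thesis unfolding Feq by simp
      qed
      ultimately show ?thesis by simp
    qed
    have 4: "(\<lambda>n. LINT x|lborel. F n x) \<longlonglongrightarrow> 1"
    proof -
      \<comment> \<open>Height n + 1 for f is height n + 1 + \<eta> for g; the ratio of the two
        heights tends to 1, so the mass is unaffected.\<close>
      define \<omega> where "\<omega> n = real (Suc n) + \<eta>" for n
      have "((\<lambda>y. Re (\<i> * of_real y * g (\<i> * of_real y))) \<longlongrightarrow> Re 1) at_top"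
        by (intro tendsto_intros axis)
      moreover have "filterlim \<omega> at_top sequentially"
        using filterlim_real_sequentially
        by (rule filterlim_at_top_mono) (use \<eta> in \<open>simp add: \<omega>_def\<close>)
      ultimately have "(\<lambda>n. Re (\<i> * of_real (\<omega> n) * g (\<i> * of_real (\<omega> n)))) \<longlonglongrightarrow> Re 1"
        by (rule filterlim_compose)
      moreover have "(\<lambda>n. 1 / (1 + \<eta> * inverse (real (Suc n)))) \<longlonglongrightarrow> 1 / (1 + \<eta> * 0)"
        by (intro tendsto_intros LIMSEQ_inverse_real_of_nat) auto
      ultimately have "(\<lambda>n. (1 / (1 + \<eta> * inverse (real (Suc n)))) * Re (\<i> * of_real (\<omega> n) * g (\<i> * of_real (\<omega> n))))
          \<longlonglongrightarrow> (1 / (1 + \<eta> * 0)) * Re 1"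
        by (intro tendsto_mult)
      moreover have "(1 / (1 + \<eta> * inverse (real (Suc n)))) * Re (\<i> * of_real (\<omega> n) * g (\<i> * of_real (\<omega> n)))
          = (LINT x|lborel. F n x)" for n
      proof -
        have "(LINT x|lborel. F n x) = - real (Suc n) * Im (f (\<i> * of_real (real (Suc n))))"
          using F[of n] by (simp add: has_bochner_integral_iff)
        moreover have "\<i> * of_real (real (Suc n)) + \<i> * of_real \<eta> = \<i> * complex_of_real (\<omega> n)"
          by (simp add: \<omega>_def algebra_simps)
        then have "f (\<i> * of_real (real (Suc n))) = g (\<i> * of_real (\<omega> n))" unfolding f_def by (simp only:)
        moreover have "1 / (1 + \<eta> * inverse (real (Suc n))) = real (Suc n) / \<omega> n"
          by (simp add: \<omega>_def divide_simps)
        moreover have "\<omega> n > 0" using \<eta> by (simp add: \<omega>_def add_pos_pos)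
        ultimately show ?thesis by (simp del: of_nat_Suc)
      qed
      ultimately show ?thesis by simp
    qed
    have i: "integrable lborel (F n)" for n using F[of n] by (rule integrable.intros)
    show "integrable lborel p" "(LINT x|lborel. p x) = 1"
      using integral_monotone_convergence_nonneg[of lborel F p 1, OF i _ _ _ 4] 1 2 3 by auto
  qed
  define \<rho> where "\<rho> = density lborel (\<lambda>x. ennreal (p x))"
  have "prob_space \<rho>"
  proof
    have "emeasure \<rho> (space \<rho>) = (\<integral>\<^sup>+x. ennreal (p x) \<partial>lborel)"
      by (simp add: \<rho>_def emeasure_density)
    also have "\<dots> = 1" using nn_integral_eq_integral[OF mass(1)] p0 mass(2) by simp
    finally show "emeasure \<rho> (space \<rho>) = 1" .
  qed
  then interpret \<rho>: real_distribution \<rho>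
    by (simp add: real_distribution_def real_distribution_axioms_def \<rho>_def)
  define d where "d z = cauchy_transform \<rho> z - f z" for z
  have Imd: "Im (d z) = 0" if z: "Im z > 0" for z
  proof -
    have eq: "p x *\<^sub>R (1 / (cmod (z - of_real x))\<^sup>2) = (pi / Im z) * (p x * poisson_kernel (Im z) (x - Re z))" for x
      unfolding poisson_kernel_def cmod_power2 using z by (simp add: power2_commute)
    have "(LINT s|\<rho>. 1 / (cmod (z - of_real s))\<^sup>2) = (LINT x|lborel. p x *\<^sub>R (1 / (cmod (z - of_real x))\<^sup>2))"
      unfolding \<rho>_def by (rule integral_density) (use p0 in auto)
    also have "\<dots> = (pi / Im z) * (- Im (f z) / pi)"
      unfolding eq integral_mult_right_zero using pois[OF z] by (simp add: has_bochner_integral_iff)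
    finally show ?thesis using \<rho>.Im_cauchy_transform[OF z] z by (simp add: d_def)
  qed
  have dhol: "d holomorphic_on uhp"
    unfolding d_def using \<eta>
    by (intro holomorphic_intros \<rho>.cauchy_transform_holomorphic holomorphic_on_subset[OF fhol]) auto
  have dconst: "d w = d a" if "Im w > 0" "Im a > 0" for w a
    using schwarz_pick[OF dhol _ that] Imd that
    by (simp add: mult_le_0_iff)
  have "d z = 0" if z: "Im z > 0" for z
  proof -
    have le: "cmod (d z) \<le> 2 * inverse y" if y: "y > 0" for y
    proof -
      have "cmod (f (\<i> * of_real y)) \<le> 1 / y"
        using order_trans[OF fb[of "\<i> * of_real y"], of "1 / y"] y \<eta> by (simp add: frac_le)
      moreover have "d z = d (\<i> * of_real y)" using dconst[OF z] y by simp
      ultimately show ?thesis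
        using \<rho>.norm_cauchy_transform_le[of "\<i> * of_real y"] y
          norm_triangle_ineq4[of "cauchy_transform \<rho> (\<i> * of_real y)" "f (\<i> * of_real y)"]
        by (simp add: d_def inverse_eq_divide)
    qed
    have "((\<lambda>y::real. 2 * inverse y) \<longlongrightarrow> 2 * 0) at_top"
      by (intro tendsto_intros tendsto_inverse_0_at_top filterlim_ident)
    moreover have "eventually (\<lambda>y. cmod (d z) \<le> 2 * inverse y) at_top"
      using eventually_gt_at_top[of 0] by eventually_elim (rule le)
    ultimately have "cmod (d z) \<le> 2 * 0" by (rule tendsto_lowerbound) simp
    then show ?thesis by simp
  qed
  then have "\<forall>z\<in>uhp. cauchy_transform \<rho> z = g (z + \<i> * of_real \<eta>)"
    by (auto simp: d_def f_def)
  then show ?thesis using \<rho>.real_distribution_axioms by (auto intro!: exI[of _ \<rho>] \<rho>.real_distribution_axioms)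
qed

text \<open>The translates of g = 1 / (z + N z) by i/(n+1) are Cauchy transforms of measures. Their
  axis asymptotics are uniform in n, which gives tightness; the Cauchy kernel is bounded and
  continuous in s, so a weak subsequential limit has transform g.\<close>

theorem exists_real_distribution_reciprocal_cauchy:
  assumes N: "sublinear_pick N"
  shows "\<exists>\<rho>. real_distribution \<rho> \<and> (\<forall>z\<in>uhp. reciprocal_cauchy \<rho> z = z + N z)"
proof -
  define g where "g z = 1 / (z + N z)" for z
  have ImF: "Im z \<le> Im (z + N z)" if "Im z > 0" for z
    using sublinear_pickD(2)[OF N that] by simp
  have ne: "z + N z \<noteq> 0" if "Im z > 0" for z using ImF[OF that] that by (metis less_le_not_le zero_complex.sel(2))
  have ghol: "g holomorphic_on uhp"
    unfolding g_def using ne by (intro holomorphic_intros sublinear_pickD(1)[OF N]) auto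
  have gb: "cmod (g z) \<le> 1 / Im z" if "Im z > 0" for z
  proof -
    have "Im z \<le> cmod (z + N z)" using ImF[OF that] abs_Im_le_cmod[of "z + N z"] by linarith
    then show ?thesis using that by (simp add: g_def norm_divide frac_le)
  qed
  have gneg: "Im (g z) \<le> 0" if "Im z > 0" for z
    unfolding g_def Im_divide using ImF[OF that] that by (simp add: divide_nonpos_nonneg)
  have axis: "((\<lambda>y. \<i> * of_real y * g (\<i> * of_real y)) \<longlongrightarrow> 1) at_top"
  proof -
    have "((\<lambda>y. 1 / (1 - \<i> * (N (\<i> * of_real y) / of_real y))) \<longlongrightarrow> 1 / (1 - \<i> * 0)) at_top"
      by (intro tendsto_intros sublinear_pickD(3)[OF N]) auto
    then have "((\<lambda>y. 1 / (1 - \<i> * (N (\<i> * of_real y) / of_real y))) \<longlongrightarrow> 1) at_top" by simp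
    moreover have "eventually (\<lambda>y. 1 / (1 - \<i> * (N (\<i> * of_real y) / of_real y)) = \<i> * of_real y * g (\<i> * of_real y)) at_top"
      using eventually_gt_at_top[of 0]
    proof eventually_elim
      case (elim y)
      have "1 - \<i> * (N (\<i> * of_real y) / of_real y) = (\<i> * of_real y + N (\<i> * of_real y)) / (\<i> * of_real y)"
        using elim by (simp add: field_simps)
      then show ?case by (simp add: g_def)
    qed
    ultimately show ?thesis by (rule Lim_transform_eventually)
  qed
  have "\<exists>\<rho>. real_distribution \<rho> \<and> (\<forall>z\<in>uhp. cauchy_transform \<rho> z = g (z + \<i> * of_real (inverse (real (Suc n)))))" for n
    by (rule exists_cauchy_transform_shift[OF ghol gb gneg axis]) auto
  then obtain \<rho> where \<rho>: "\<And>n. real_distribution (\<rho> n)"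
    "\<And>n z. Im z > 0 \<Longrightarrow> cauchy_transform (\<rho> n) z = g (z + \<i> * of_real (inverse (real (Suc n))))"
    by (metis mem_Collect_eq)
  have "tight \<rho>"
    unfolding tight_def
  proof (intro conjI allI impI \<rho>(1))
    fix e :: real assume e: "e > 0"
    \<comment> \<open>The mass bound below is 2 (1 - d)^2 - 1 \<ge> 1 - 4 d, which exceeds 1 - e
      when d \<le> e/8. The cap 1/2 keeps 1 - d positive.\<close>
    define d where "d = min (e / 8) (1 / 2)"
    have d: "d > 0" "d \<le> e / 8" "d < 1" using e by (auto simp: d_def min_less_iff_disj)
    have "((\<lambda>y. Re (\<i> * of_real y * g (\<i> * of_real y))) \<longlongrightarrow> Re 1) at_top"
      by (intro tendsto_intros axis)
    then have "eventually (\<lambda>y. Re (\<i> * of_real y * g (\<i> * of_real y)) > 1 - d) at_top"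
      by (rule order_tendstoD) (use d in simp)
    then obtain W where W: "\<And>y. y \<ge> W \<Longrightarrow> Re (\<i> * of_real y * g (\<i> * of_real y)) > 1 - d"
      unfolding eventually_at_top_linorder by blast
    \<comment> \<open>Y \<ge> 1/d gives Y / (Y + 1) \<ge> 1 - d, which absorbs the shift in height,
      at most 1, simultaneously for all n.\<close>
    define Y where "Y = max W (1 / d)"
    have Y: "Y \<ge> W" "Y \<ge> 1 / d" "Y > 0" using d by (auto simp: Y_def less_max_iff_disj)
    have "measure (\<rho> n) {- Y<..Y} > 1 - e" for n
    proof -
      interpret real_distribution "\<rho> n" by (rule \<rho>(1))
      define \<omega> where "\<omega> = Y + inverse (real (Suc n))"
      have "inverse (real (Suc n)) \<le> 1" by (simp add: inverse_le_1_iff)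
      then have \<omega>: "\<omega> \<ge> Y" "\<omega> \<le> Y + 1" by (auto simp: \<omega>_def)
      have eq: "Y * Y * (1 / (cmod (\<i> * of_real Y - of_real s))\<^sup>2) = Y\<^sup>2 / (s\<^sup>2 + Y\<^sup>2)" for s
        unfolding cmod_power2 by (simp add: power2_eq_square)
      have int: "integrable (\<rho> n) (\<lambda>s. Y\<^sup>2 / (s\<^sup>2 + Y\<^sup>2))"
      proof (rule integrable_const_bound[where B = 1])
        have "Y\<^sup>2 / (s\<^sup>2 + Y\<^sup>2) \<le> 1" for s
          using Y by (subst divide_le_eq_1_pos) (auto intro!: add_nonneg_pos)
        then show "AE s in \<rho> n. norm (Y\<^sup>2 / (s\<^sup>2 + Y\<^sup>2)) \<le> 1" by simp
      qed simp
      have "(LINT s|\<rho> n. Y\<^sup>2 / (s\<^sup>2 + Y\<^sup>2)) = - Y * Im (cauchy_transform (\<rho> n) (\<i> * of_real Y))"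
        using Im_cauchy_transform[of "\<i> * of_real Y"] Y
        unfolding eq[symmetric] integral_mult_right_zero by simp
      also have "cauchy_transform (\<rho> n) (\<i> * of_real Y) = g (\<i> * of_real \<omega>)"
        using \<rho>(2)[of "\<i> * of_real Y" n] Y by (simp add: \<omega>_def distrib_left)
      also have "- Y * Im (g (\<i> * of_real \<omega>)) = (Y / \<omega>) * Re (\<i> * of_real \<omega> * g (\<i> * of_real \<omega>))"
        using \<omega> Y by simp
      finally have I: "(LINT s|\<rho> n. Y\<^sup>2 / (s\<^sup>2 + Y\<^sup>2)) = (Y / \<omega>) * Re (\<i> * of_real \<omega> * g (\<i> * of_real \<omega>))" .
      have "1 - d \<le> Y / (Y + 1)" using Y d by (simp add: field_simps)
      also have "\<dots> \<le> Y / \<omega>" using \<omega> Y by (intro divide_left_mono) auto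
      finally have "(1 - d) * (1 - d) \<le> (LINT s|\<rho> n. Y\<^sup>2 / (s\<^sup>2 + Y\<^sup>2))"
        unfolding I using W[of \<omega>] \<omega> Y d by (intro mult_mono) auto
      moreover have "(1 - d) * (1 - d) \<ge> 1 - 2 * d" by (simp add: algebra_simps)
      ultimately have "2 * (LINT s|\<rho> n. Y\<^sup>2 / (s\<^sup>2 + Y\<^sup>2)) - 1 > 1 - e" using d e by linarith
      also have "2 * (LINT s|\<rho> n. Y\<^sup>2 / (s\<^sup>2 + Y\<^sup>2)) - 1 = (LINT s|\<rho> n. 2 * (Y\<^sup>2 / (s\<^sup>2 + Y\<^sup>2)) - 1)"
      proof -
        have "(LINT s|\<rho> n. 2 * (Y\<^sup>2 / (s\<^sup>2 + Y\<^sup>2)) - 1)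
            = (LINT s|\<rho> n. 2 * (Y\<^sup>2 / (s\<^sup>2 + Y\<^sup>2))) - (LINT s|\<rho> n. 1)"
          by (rule Bochner_Integration.integral_diff) (rule integrable_mult_right[OF int], simp)
        then show ?thesis unfolding integral_mult_right_zero using prob_space by simp
      qed
      \<comment> \<open>The fraction is at most 1 everywhere and at most 1/2 once |s| \<ge> Y, so
        twice the fraction minus 1 lies below the indicator.\<close>
      also have "\<dots> \<le> (LINT s|\<rho> n. indicator {- Y<..Y} s)"
      proof (rule integral_mono)
        fix s
        have pos: "s\<^sup>2 + Y\<^sup>2 > 0" using Y by (intro add_nonneg_pos) auto
        show "2 * (Y\<^sup>2 / (s\<^sup>2 + Y\<^sup>2)) - 1 \<le> indicator {- Y<..Y} s"
        proof (cases "\<bar>s\<bar> < Y")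
          case True
          then have "s \<in> {- Y<..Y}" by auto
          moreover have "Y\<^sup>2 / (s\<^sup>2 + Y\<^sup>2) \<le> 1" using pos by (simp add: divide_le_eq)
          ultimately show ?thesis by simp
        next
          case False
          then have "Y\<^sup>2 \<le> s\<^sup>2" using Y by (simp add: abs_le_square_iff[symmetric])
          then have "2 * (Y\<^sup>2 / (s\<^sup>2 + Y\<^sup>2)) - 1 \<le> 0" using pos by (simp add: divide_le_eq)
          then show ?thesis by (meson indicator_pos_le order_trans)
        qed
        show "integrable (\<rho> n) (\<lambda>s. 2 * (Y\<^sup>2 / (s\<^sup>2 + Y\<^sup>2)) - 1)"
          by (rule Bochner_Integration.integrable_diff[OF integrable_mult_right[OF int]]) simp
        show "integrable (\<rho> n) (indicat_real {- Y<..Y})"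
          by (rule integrable_const_bound[where B = 1]) (auto simp: indicator_def)
      qed
      also have "\<dots> = measure (\<rho> n) {- Y<..Y}" by simp
      finally show ?thesis .
    qed
    then show "\<exists>a b. a < b \<and> (\<forall>n. 1 - e < measure (\<rho> n) {a<..b})"
      using Y by (intro exI[of _ "- Y"] exI[of _ Y]) auto
  qed
  then obtain r M where r: "strict_mono (r :: nat \<Rightarrow> nat)" and M: "real_distribution M" "weak_conv_m (\<rho> \<circ> id \<circ> r) M"
    using tight_imp_convergent_subsubsequence[of \<rho> id] by (auto simp: strict_mono_def)
  have lim: "cauchy_transform M z = g z" if z: "Im z > 0" for z
  proof -
    have "(\<lambda>n. LINT s|(\<rho> \<circ> id \<circ> r) n. 1 / (z - complex_of_real s)) \<longlonglongrightarrow> (LINT s|M. 1 / (z - complex_of_real s))"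
    proof (rule weak_conv_imp_integral_bdd_continuous_conv[OF _ M(1) M(2), where B = "1 / Im z"])
      show "real_distribution ((\<rho> \<circ> id \<circ> r) n)" for n using \<rho>(1) by simp
      show "isCont (\<lambda>s. 1 / (z - complex_of_real s)) x" for x
        using norm_cauchy_kernel_le(3)[OF z] by (intro continuous_intros) auto
      show "cmod (1 / (z - complex_of_real x)) \<le> 1 / Im z" for x by (rule norm_cauchy_kernel_le(1)[OF z])
    qed
    then have "(\<lambda>n. g (z + \<i> * of_real (inverse (real (Suc (r n)))))) \<longlonglongrightarrow> cauchy_transform M z"
      unfolding cauchy_transform_def[symmetric] using \<rho>(2)[OF z] by simp
    moreover have "(\<lambda>n. g (z + \<i> * of_real (inverse (real (Suc (r n)))))) \<longlonglongrightarrow> g z"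
    proof (rule isCont_tendsto_compose[of z g])
      show "isCont g z"
        using holomorphic_on_imp_continuous_on[OF ghol] open_uhp z by (auto simp: continuous_on_eq_continuous_at)
      have "(\<lambda>n. inverse (real (Suc (r n)))) \<longlonglongrightarrow> 0"
        using LIMSEQ_subseq_LIMSEQ[OF LIMSEQ_inverse_real_of_nat r] by (simp add: o_def)
      then have "(\<lambda>n. z + \<i> * of_real (inverse (real (Suc (r n))))) \<longlonglongrightarrow> z + \<i> * of_real 0"
        by (intro tendsto_intros)
      then show "(\<lambda>n. z + \<i> * of_real (inverse (real (Suc (r n))))) \<longlonglongrightarrow> z" by simp
    qed
    ultimately show ?thesis by (rule LIMSEQ_unique)
  qed
  show ?thesis
    using M(1) lim by (intro exI[of _ M]) (auto simp: reciprocal_cauchy_def g_def)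
qed

section \<open>Inverses on truncated cones\<close>

lemma truncated_cone_halfspaces:
  "truncated_cone \<alpha> \<beta> = {z. inner (Complex 1 (-\<alpha>)) z < 0} \<inter> {z. inner (Complex (-1) (-\<alpha>)) z < 0}
     \<inter> {z. Im z > 0} \<inter> {z. Im z > \<beta>}"
  by (auto simp: truncated_cone_def inner_complex_def)

lemma open_truncated_cone: "open (truncated_cone \<alpha> \<beta>)"
  unfolding truncated_cone_halfspaces
  by (intro open_Int open_halfspace_lt open_halfspace_Im_gt)

lemma convex_truncated_cone: "convex (truncated_cone \<alpha> \<beta>)"
  unfolding truncated_cone_halfspaces
  by (intro convex_Int convex_halfspace_lt convex_halfspace_Im_gt)

lemma truncated_cone_nonempty:
  assumes "\<alpha> > 0" shows "truncated_cone \<alpha> \<beta> \<noteq> {}"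
proof -
  have "Complex 0 (max \<beta> 0 + 1) \<in> truncated_cone \<alpha> \<beta>"
    using assms by (auto simp: truncated_cone_def)
  then show ?thesis by blast
qed

lemma truncated_cone_mono:
  assumes "\<alpha>' \<le> \<alpha>" "\<beta> \<le> \<beta>'"
  shows "truncated_cone \<alpha>' \<beta>' \<subseteq> truncated_cone \<alpha> \<beta>"
proof
  fix z assume z: "z \<in> truncated_cone \<alpha>' \<beta>'"
  then have "\<alpha>' * Im z \<le> \<alpha> * Im z" using assms by (intro mult_right_mono) (auto simp: truncated_cone_def)
  moreover have "Im z > 0" "\<bar>Re z\<bar> < \<alpha>' * Im z" "Im z > \<beta>'" using z by (auto simp: truncated_cone_def)
  ultimately have "Im z > 0" "\<bar>Re z\<bar> < \<alpha> * Im z" "Im z > \<beta>" using assms by linarith+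
  then show "z \<in> truncated_cone \<alpha> \<beta>" unfolding truncated_cone_def by blast
qed

lemma norm_le_Im_on_cone:
  assumes "z \<in> truncated_cone \<alpha> \<beta>" shows "cmod z \<le> (1 + \<alpha>) * Im z"
proof -
  have "cmod z \<le> \<bar>Re z\<bar> + \<bar>Im z\<bar>" by (rule cmod_le)
  then show ?thesis using assms by (auto simp: truncated_cone_def algebra_simps)
qed

text \<open>On the cone |z| and Im z agree up to the factor 1 + \<alpha>. Measuring the error
  against Im z matches the cone estimate for Pick functions.\<close>

lemma tendsto_id_on_cone_iff:
  assumes \<alpha>: "\<alpha> > 0"
  shows "((\<lambda>z. h z / z) \<longlongrightarrow> 1) (inf at_infinity (principal (truncated_cone \<alpha> \<beta>))) \<longleftrightarrow>
    (\<forall>e>0. \<exists>b. \<forall>z\<in>truncated_cone \<alpha> \<beta>. Im z > b \<longrightarrow> cmod (h z - z) \<le> e * Im z)"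
proof -
  have eq: "dist (h z / z) 1 = cmod (h z - z) / cmod z" if "z \<in> truncated_cone \<alpha> \<beta>" for z
  proof -
    have "z \<noteq> 0" using that by (auto simp: truncated_cone_def)
    then have "h z / z - 1 = (h z - z) / z" by (simp add: field_simps)
    then show ?thesis by (simp add: dist_norm norm_divide)
  qed
  have pos: "cmod z > 0" "Im z > 0" "Im z \<le> cmod z" if "z \<in> truncated_cone \<alpha> \<beta>" for z
    using that abs_Im_le_cmod[of z] by (auto simp: truncated_cone_def)
  show ?thesis
    unfolding tendsto_iff eventually_inf_principal eventually_at_infinity
  proof (intro iffI allI impI)
    fix e :: real assume e: "e > 0"
    assume *: "\<forall>e>0. \<exists>b. \<forall>z. b \<le> cmod z \<longrightarrow> z \<in> truncated_cone \<alpha> \<beta> \<longrightarrow> dist (h z / z) 1 < e"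
    have "e / (1 + \<alpha>) > 0" using e \<alpha> by simp
    with * obtain b where b: "\<And>z. b \<le> cmod z \<Longrightarrow> z \<in> truncated_cone \<alpha> \<beta> \<Longrightarrow> dist (h z / z) 1 < e / (1 + \<alpha>)"
      by meson
    have "cmod (h z - z) \<le> e * Im z" if z: "z \<in> truncated_cone \<alpha> \<beta>" "Im z > b" for z
    proof -
      have "cmod (h z - z) / cmod z < e / (1 + \<alpha>)"
        using b[of z] z pos[OF z(1)] eq[OF z(1)] by simp
      then have "cmod (h z - z) \<le> e / (1 + \<alpha>) * cmod z"
        using pos[OF z(1)] by (simp add: field_simps)
      also have "\<dots> \<le> e / (1 + \<alpha>) * ((1 + \<alpha>) * Im z)"
        using norm_le_Im_on_cone[OF z(1)] e \<alpha> by (intro mult_left_mono) auto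
      also have "\<dots> = e * Im z" using \<alpha> by simp
      finally show ?thesis .
    qed
    then show "\<exists>b. \<forall>z\<in>truncated_cone \<alpha> \<beta>. Im z > b \<longrightarrow> cmod (h z - z) \<le> e * Im z" by blast
  next
    fix e :: real assume e: "e > 0"
    assume *: "\<forall>e>0. \<exists>b. \<forall>z\<in>truncated_cone \<alpha> \<beta>. Im z > b \<longrightarrow> cmod (h z - z) \<le> e * Im z"
    have "e / 2 > 0" using e by simp
    with * obtain b where b: "\<And>z. z \<in> truncated_cone \<alpha> \<beta> \<Longrightarrow> Im z > b \<Longrightarrow> cmod (h z - z) \<le> e / 2 * Im z"
      by meson
    have "dist (h z / z) 1 < e" if z: "z \<in> truncated_cone \<alpha> \<beta>" "(1 + \<alpha>) * (\<bar>b\<bar> + 1) \<le> cmod z" for z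
    proof -
      have "(1 + \<alpha>) * (\<bar>b\<bar> + 1) \<le> (1 + \<alpha>) * Im z" using norm_le_Im_on_cone[OF z(1)] z(2) by linarith
      then have "\<bar>b\<bar> + 1 \<le> Im z" using \<alpha> by simp
      then have "cmod (h z - z) \<le> e / 2 * Im z" using z(1) by (intro b) auto
      also have "\<dots> \<le> e / 2 * cmod z" using pos[OF z(1)] e by (intro mult_left_mono) auto
      also have "\<dots> < e * cmod z" using pos[OF z(1)] e by simp
      finally show ?thesis using pos[OF z(1)] by (simp add: eq[OF z(1)] divide_less_eq)
    qed
    then show "\<exists>b. \<forall>z. b \<le> cmod z \<longrightarrow> z \<in> truncated_cone \<alpha> \<beta> \<longrightarrow> dist (h z / z) 1 < e"
      by (intro exI[of _ "(1 + \<alpha>) * (\<bar>b\<bar> + 1)"]) auto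
  qed
qed

text \<open>The height drops by at most a factor 2, which doubles the slope and the height
  threshold; the horizontal movement adds at most 1 to the slope, rounded up to 2.\<close>

lemma near_cone_point:
  assumes z: "z \<in> truncated_cone \<alpha> (2 * \<beta>)" and w: "cmod (w - z) \<le> Im z / 2" and \<alpha>: "\<alpha> > 0"
  shows "w \<in> truncated_cone (2 * \<alpha> + 2) \<beta>" "Im w \<le> 3 / 2 * Im z"
proof -
  have I: "\<bar>Im w - Im z\<bar> \<le> Im z / 2" "\<bar>Re w - Re z\<bar> \<le> Im z / 2"
    using w abs_Im_le_cmod[of "w - z"] abs_Re_le_cmod[of "w - z"] by auto
  then show "Im w \<le> 3 / 2 * Im z" by linarith
  have z': "Im z > 0" "\<bar>Re z\<bar> < \<alpha> * Im z" "Im z > 2 * \<beta>" using z by (auto simp: truncated_cone_def)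
  have Imw: "Im z \<le> 2 * Im w" using I by linarith
  then have "\<alpha> * Im z \<le> \<alpha> * (2 * Im w)" using \<alpha> by (intro mult_left_mono) auto
  moreover have "\<bar>Re w\<bar> \<le> \<bar>Re z\<bar> + Im z / 2" using I(2) by linarith
  ultimately have "\<bar>Re w\<bar> < \<alpha> * (2 * Im w) + 2 * Im w"
    using z' Imw by linarith
  then have "\<bar>Re w\<bar> < (2 * \<alpha> + 2) * Im w"
    by (simp add: algebra_simps)
  then show "w \<in> truncated_cone (2 * \<alpha> + 2) \<beta>"
    using z' Imw by (auto simp: truncated_cone_def)
qed

text \<open>Equal images force |N w - N w'| = |w - w'|, so by Schwarz--Pick the product of the
  heights is at most that of the imaginary parts of N, which is at most 1/16 of it.\<close>

lemma pick_perturbation_inj_on: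
  assumes N: "sublinear_pick N" and small: "\<And>z. z \<in> truncated_cone \<alpha> \<beta> \<Longrightarrow> cmod (N z) \<le> (1/4) * Im z"
  shows "inj_on (\<lambda>z. z + N z) (truncated_cone \<alpha> \<beta>)"
proof (rule inj_onI, rule ccontr)
  fix w w' assume w: "w \<in> truncated_cone \<alpha> \<beta>" "w' \<in> truncated_cone \<alpha> \<beta>" and eq: "w + N w = w' + N w'" and ne: "w \<noteq> w'"
  have pos: "Im w > 0" "Im w' > 0" using w by (auto simp: truncated_cone_def)
  have "N w - N w' = ((w + N w) - (w' + N w')) - (w - w')" by simp
  also have "\<dots> = - (w - w')" unfolding eq by simp
  finally have "N w - N w' = - (w - w')" .
  then have "cmod (N w - N w') = cmod (w - w')" by (simp only: norm_minus_cancel)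
  then have "(cmod (w - w'))\<^sup>2 * (Im w * Im w') \<le> (cmod (w - w'))\<^sup>2 * (Im (N w) * Im (N w'))"
    using sublinear_pick_schwarz[OF N pos] by simp
  then have "Im w * Im w' \<le> Im (N w) * Im (N w')" using ne by simp
  also have "\<dots> \<le> ((1/4) * Im w) * ((1/4) * Im w')"
    using small[OF w(1)] small[OF w(2)] abs_Im_le_cmod[of "N w"] abs_Im_le_cmod[of "N w'"]
      sublinear_pickD(2)[OF N] pos by (intro mult_mono) auto
  also have "\<dots> = (1/16) * (Im w * Im w')" by simp
  finally show False using mult_pos_pos[OF pos] by linarith
qed

text \<open>On a wide cone z + N z is injective and so has a holomorphic inverse on its image.
  Brouwer's theorem for w \<mapsto> z - N w on a disc around z shows that the image contains the
  narrower cone and that the preimage is close to z.\<close>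

theorem exists_inverse_on_cone:
  assumes N: "sublinear_pick N" and \<alpha>: "\<alpha> > 0"
  shows "\<exists>\<beta>>0. \<exists>h. h holomorphic_on truncated_cone \<alpha> \<beta> \<and>
    (\<forall>z\<in>truncated_cone \<alpha> \<beta>. Im (h z) > 0 \<and> h z + N (h z) = z) \<and>
    ((\<lambda>z. h z / z) \<longlongrightarrow> 1) (inf at_infinity (principal (truncated_cone \<alpha> \<beta>)))"
proof -
  define A where "A = 2 * \<alpha> + 2"
  obtain b where b: "b > 0" "\<And>z. z \<in> truncated_cone A b \<Longrightarrow> cmod (N z) \<le> (1/4) * Im z"
    using sublinear_pick_cone_le[OF N, of "1/4" A] by auto
  let ?\<Omega> = "truncated_cone A b" and ?C = "truncated_cone \<alpha> (2 * b)"
  have uhp: "?\<Omega> \<subseteq> uhp" by (auto simp: truncated_cone_def)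
  have Nhol: "N holomorphic_on ?\<Omega>" using sublinear_pickD(1)[OF N] uhp by (rule holomorphic_on_subset)
  have "(\<lambda>z. z + N z) holomorphic_on ?\<Omega>" by (intro holomorphic_intros Nhol)
  then obtain h where h: "h holomorphic_on ((\<lambda>z. z + N z) ` ?\<Omega>)" "\<And>z. z \<in> ?\<Omega> \<Longrightarrow> h (z + N z) = z"
    using holomorphic_has_inverse[OF _ open_truncated_cone pick_perturbation_inj_on[OF N b(2)]] by metis
  have ex: "\<exists>w. cmod (w - z) \<le> Im z / 2 \<and> w + N w = z" if z: "z \<in> ?C" for z
  proof -
    let ?K = "cball z (Im z / 2)"
    have K: "w \<in> ?\<Omega>" "Im w \<le> 3 / 2 * Im z" if "w \<in> ?K" for w
      using near_cone_point[OF z _ \<alpha>, of w] that by (auto simp: A_def dist_norm norm_minus_commute)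
    have "continuous_on ?K (\<lambda>w. z - N w)"
      using holomorphic_on_imp_continuous_on[OF Nhol] K(1)
      by (intro continuous_intros) (rule continuous_on_subset, auto)
    moreover have "(\<lambda>w. z - N w) \<in> ?K \<rightarrow> ?K"
    proof
      fix w assume "w \<in> ?K"
      \<comment> \<open>The product 3/8 is below 1/2, so the map keeps the disc of radius Im z /
        2.\<close>
      then have "cmod (N w) \<le> (1/4) * (3 / 2 * Im z)" using b(2)[OF K(1)] K(2) by force
      then show "z - N w \<in> ?K" using z by (auto simp: dist_norm truncated_cone_def)
    qed
    moreover have "?K \<noteq> {}" using z by (auto simp: truncated_cone_def)
    ultimately obtain w where "w \<in> ?K" "z - N w = w"
      using brouwer[of ?K "\<lambda>w. z - N w"] compact_cball convex_cball by metis
    then show ?thesis by (intro exI[of _ w]) (auto simp: dist_norm norm_minus_commute algebra_simps)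
  qed
  have hz: "cmod (h z - z) \<le> Im z / 2" "h z \<in> ?\<Omega>" "h z + N (h z) = z" "z \<in> (\<lambda>z. z + N z) ` ?\<Omega>"
    if z: "z \<in> ?C" for z
  proof -
    obtain w where w: "cmod (w - z) \<le> Im z / 2" "w + N w = z" using ex[OF z] by blast
    have "w \<in> ?\<Omega>" using near_cone_point(1)[OF z w(1) \<alpha>] by (simp add: A_def)
    moreover from h(2)[OF this] have "h z = w" by (simp add: w(2))
    moreover have "z \<in> (\<lambda>z. z + N z) ` ?\<Omega>"
      using \<open>w \<in> ?\<Omega>\<close> w(2) by (intro image_eqI[of _ _ w]) simp_all
    ultimately show "cmod (h z - z) \<le> Im z / 2" "h z \<in> ?\<Omega>" "h z + N (h z) = z" "z \<in> (\<lambda>z. z + N z) ` ?\<Omega>"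
      using w by auto
  qed
  have lim: "\<exists>c. \<forall>z\<in>?C. Im z > c \<longrightarrow> cmod (h z - z) \<le> e * Im z" if e: "e > 0" for e
  proof -
    \<comment> \<open>The factor 2/3 offsets \<open>Im (h z) \<le> 3 / 2 * Im z\<close>.\<close>
    have "2 / 3 * e > 0" using e by simp
    from sublinear_pick_cone_le[OF N this, of A]
    obtain c where c: "c > 0" "\<And>z. z \<in> truncated_cone A c \<Longrightarrow> cmod (N z) \<le> 2 / 3 * e * Im z"
      by blast
    have "cmod (h z - z) \<le> e * Im z" if z: "z \<in> ?C" "Im z > 2 * c" for z
    proof -
      have "z \<in> truncated_cone \<alpha> (2 * c)" using z by (auto simp: truncated_cone_def)
      from near_cone_point[OF this hz(1)[OF z(1)] \<alpha>]
      have *: "h z \<in> truncated_cone A c" "Im (h z) \<le> 3 / 2 * Im z" by (auto simp: A_def)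
      have "h z - (h z + N (h z)) = - N (h z)" by simp
      then have "cmod (h z - z) = cmod (N (h z))" unfolding hz(3)[OF z(1)] by simp
      also have "\<dots> \<le> 2 / 3 * e * Im (h z)" using c(2)[OF *(1)] .
      also have "\<dots> \<le> 2 / 3 * e * (3 / 2 * Im z)" using *(2) e by (intro mult_left_mono) auto
      finally show ?thesis by simp
    qed
    then show ?thesis by blast
  qed
  have "h holomorphic_on ?C" using h(1) by (rule holomorphic_on_subset) (use hz(4) in auto)
  moreover have "\<forall>z\<in>?C. Im (h z) > 0 \<and> h z + N (h z) = z" using hz(2,3) uhp by auto
  moreover have "((\<lambda>z. h z / z) \<longlongrightarrow> 1) (inf at_infinity (principal ?C))"
    unfolding tendsto_id_on_cone_iff[OF \<alpha>] using lim by blast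
  ultimately show ?thesis using b(1) by (intro exI[of _ "2 * b"]) auto
qed

lemma exists_right_inverse_on_cone:
  assumes "real_distribution \<mu>" "\<alpha> > 0"
  shows "\<exists>\<beta>>0. \<exists>h. is_right_inverse_on_cone \<mu> \<alpha> \<beta> h"
  using exists_inverse_on_cone[OF real_distribution.sublinear_pick_reciprocal_cauchy[OF assms(1)] assms(2)]
  by (simp add: is_right_inverse_on_cone_def)

lemma right_inverse_on_cone_mono:
  assumes h: "is_right_inverse_on_cone \<mu> \<alpha> \<beta> h" and le: "\<alpha>' \<le> \<alpha>" "\<beta> \<le> \<beta>'"
  shows "is_right_inverse_on_cone \<mu> \<alpha>' \<beta>' h"
proof -
  have sub: "truncated_cone \<alpha>' \<beta>' \<subseteq> truncated_cone \<alpha> \<beta>" by (rule truncated_cone_mono[OF le])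
  then have le: "inf at_infinity (principal (truncated_cone \<alpha>' \<beta>')) \<le> inf at_infinity (principal (truncated_cone \<alpha> \<beta>))"
    by (intro inf_mono) auto
  then show ?thesis
    using h sub tendsto_mono[OF le] holomorphic_on_subset[OF _ sub]
    unfolding is_right_inverse_on_cone_def by blast
qed

text \<open>At large heights the asymptotics place both values in a cone where F is injective, so
  they agree there; the identity theorem extends this to the whole cone.\<close>

lemma right_inverse_on_cone_unique:
  assumes \<mu>: "real_distribution \<mu>" and \<alpha>: "\<alpha> > 0"
    and h: "is_right_inverse_on_cone \<mu> \<alpha> \<beta> h" and k: "is_right_inverse_on_cone \<mu> \<alpha> \<beta> k"
    and z: "z \<in> truncated_cone \<alpha> \<beta>"
  shows "h z = k z"
proof -
  define N where "N z = reciprocal_cauchy \<mu> z - z" for z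
  have N: "sublinear_pick N"
    using real_distribution.sublinear_pick_reciprocal_cauchy[OF \<mu>] by (simp add: N_def[abs_def])
  obtain b where b: "b > 0" "\<And>z. z \<in> truncated_cone (2 * \<alpha> + 2) b \<Longrightarrow> cmod (N z) \<le> (1/4) * Im z"
    using sublinear_pick_cone_le[OF N, of "1/4" "2 * \<alpha> + 2"] by auto
  have near: "\<exists>c. \<forall>z\<in>truncated_cone \<alpha> \<beta>. Im z > c \<longrightarrow> cmod (g z - z) \<le> (1/2) * Im z"
    if "is_right_inverse_on_cone \<mu> \<alpha> \<beta> g" for g
  proof -
    have "((\<lambda>z. g z / z) \<longlongrightarrow> 1) (inf at_infinity (principal (truncated_cone \<alpha> \<beta>)))"
      using that by (simp add: is_right_inverse_on_cone_def)
    then have "\<forall>e>0. \<exists>c. \<forall>z\<in>truncated_cone \<alpha> \<beta>. Im z > c \<longrightarrow> cmod (g z - z) \<le> e * Im z"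
      unfolding tendsto_id_on_cone_iff[OF \<alpha>] .
    then show ?thesis by (rule allE[of _ "1/2"]) simp
  qed
  from near[OF h] obtain c where c: "\<And>z. z \<in> truncated_cone \<alpha> \<beta> \<Longrightarrow> Im z > c \<Longrightarrow> cmod (h z - z) \<le> (1/2) * Im z"
    by blast
  from near[OF k] obtain d where d: "\<And>z. z \<in> truncated_cone \<alpha> \<beta> \<Longrightarrow> Im z > d \<Longrightarrow> cmod (k z - z) \<le> (1/2) * Im z"
    by blast
  define m where "m = max (max c d) (max \<beta> (2 * b))"
  have eq: "h z = k z" if z: "z \<in> truncated_cone \<alpha> m" for z
  proof -
    have z1: "z \<in> truncated_cone \<alpha> \<beta>" "z \<in> truncated_cone \<alpha> (2 * b)" "Im z > c" "Im z > d"
      using z by (auto simp: truncated_cone_def m_def)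
    have "h z \<in> truncated_cone (2 * \<alpha> + 2) b" "k z \<in> truncated_cone (2 * \<alpha> + 2) b"
      using near_cone_point(1)[OF z1(2) _ \<alpha>] c d z1 by auto
    moreover have "h z + N (h z) = k z + N (k z)"
      using h k z1(1) by (simp add: is_right_inverse_on_cone_def N_def)
    ultimately show ?thesis
      using pick_perturbation_inj_on[OF N b(2)] by (auto simp: inj_on_def)
  qed
  show ?thesis
  proof (rule analytic_continuation_open[of "truncated_cone \<alpha> m" "truncated_cone \<alpha> \<beta>" h k])
    show "truncated_cone \<alpha> m \<subseteq> truncated_cone \<alpha> \<beta>"
      by (rule truncated_cone_mono) (auto simp: m_def)
    show "h holomorphic_on truncated_cone \<alpha> \<beta>" "k holomorphic_on truncated_cone \<alpha> \<beta>"
      using h k by (auto simp: is_right_inverse_on_cone_def)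
  qed (use z eq open_truncated_cone convex_connected[OF convex_truncated_cone] truncated_cone_nonempty[OF \<alpha>] in auto)
qed

section \<open>Recovering a measure from its reciprocal Cauchy transform or from a right inverse of
  it\<close>

lemma reciprocal_cauchy_unique:
  assumes \<mu>: "real_distribution \<mu>" and \<nu>: "real_distribution \<nu>"
    and eq: "\<And>z. Im z > 0 \<Longrightarrow> reciprocal_cauchy \<mu> z = reciprocal_cauchy \<nu> z"
  shows "\<mu> = \<nu>"
proof (rule cauchy_transform_unique[OF \<mu> \<nu>])
  show "cauchy_transform \<mu> z = cauchy_transform \<nu> z" if "Im z > 0" for z
    using eq[OF that] by (simp add: reciprocal_cauchy_def)
qed

lemma reciprocal_cauchy_holomorphic:
  assumes "real_distribution \<mu>" shows "reciprocal_cauchy \<mu> holomorphic_on uhp"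
proof -
  have "(\<lambda>z. (reciprocal_cauchy \<mu> z - z) + z) holomorphic_on uhp"
    by (intro holomorphic_intros sublinear_pickD(1)[OF real_distribution.sublinear_pick_reciprocal_cauchy[OF assms]])
  then show ?thesis by simp
qed

text \<open>Both reciprocal Cauchy transforms invert h on the image of the cone. That image is open
  because h is injective, so they agree on the half-plane by analytic continuation.\<close>

lemma eq_if_same_right_inverse:
  assumes \<mu>: "real_distribution \<mu>" and \<nu>: "real_distribution \<nu>" and \<alpha>: "\<alpha> > 0"
    and h: "is_right_inverse_on_cone \<mu> \<alpha> \<beta> h" and k: "is_right_inverse_on_cone \<nu> \<alpha> \<beta> k"
    and eq: "\<And>z. z \<in> truncated_cone \<alpha> \<beta> \<Longrightarrow> h z = k z"
  shows "\<mu> = \<nu>"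
proof (rule reciprocal_cauchy_unique[OF \<mu> \<nu>])
  fix z assume z: "Im z > 0"
  let ?C = "truncated_cone \<alpha> \<beta>"
  have hC: "h holomorphic_on ?C" "\<And>z. z \<in> ?C \<Longrightarrow> Im (h z) > 0 \<and> reciprocal_cauchy \<mu> (h z) = z"
    using h by (auto simp: is_right_inverse_on_cone_def)
  have kC: "\<And>z. z \<in> ?C \<Longrightarrow> reciprocal_cauchy \<nu> (h z) = z"
    using k eq by (auto simp: is_right_inverse_on_cone_def)
  have "inj_on h ?C" using hC(2) by (metis inj_onI)
  then have "open (h ` ?C)" by (rule open_mapping_thm3[OF hC(1) open_truncated_cone])
  then show "reciprocal_cauchy \<mu> z = reciprocal_cauchy \<nu> z"
    by (rule analytic_continuation_open[of "h ` ?C" uhp "reciprocal_cauchy \<mu>" "reciprocal_cauchy \<nu>"])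
      (use hC(2) kC z truncated_cone_nonempty[OF \<alpha>] reciprocal_cauchy_holomorphic[OF \<mu>] reciprocal_cauchy_holomorphic[OF \<nu>]
          open_uhp convex_connected[OF convex_uhp] in auto)
qed

section \<open>Free and Boolean powers\<close>

lemma voiculescu_transform_unique:
  assumes \<mu>: "real_distribution \<mu>" and \<alpha>: "\<alpha> > 0" "\<alpha>' > 0"
    and V: "is_voiculescu_transform \<mu> \<alpha> \<beta> V" and V': "is_voiculescu_transform \<mu> \<alpha>' \<beta>' V'"
    and z: "z \<in> truncated_cone (min \<alpha> \<alpha>') (max \<beta> \<beta>')"
  shows "V z = V' z"
proof -
  obtain h where h: "is_right_inverse_on_cone \<mu> \<alpha> \<beta> h" "\<And>z. z \<in> truncated_cone \<alpha> \<beta> \<Longrightarrow> V z = h z - z"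
    using V by (auto simp: is_voiculescu_transform_def)
  obtain k where k: "is_right_inverse_on_cone \<mu> \<alpha>' \<beta>' k" "\<And>z. z \<in> truncated_cone \<alpha>' \<beta>' \<Longrightarrow> V' z = k z - z"
    using V' by (auto simp: is_voiculescu_transform_def)
  have "h z = k z"
    by (rule right_inverse_on_cone_unique[OF \<mu> _ right_inverse_on_cone_mono[OF h(1)] right_inverse_on_cone_mono[OF k(1)] z])
       (use \<alpha> in auto)
  moreover have "z \<in> truncated_cone \<alpha> \<beta>" "z \<in> truncated_cone \<alpha>' \<beta>'"
    using z truncated_cone_mono[of "min \<alpha> \<alpha>'" \<alpha> \<beta> "max \<beta> \<beta>'"] truncated_cone_mono[of "min \<alpha> \<alpha>'" \<alpha>' \<beta>' "max \<beta> \<beta>'"] by auto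
  ultimately show ?thesis using h(2) k(2) by simp
qed

lemma eq_if_same_voiculescu_transform:
  assumes \<mu>: "real_distribution \<mu>" "real_distribution \<nu>" and \<alpha>: "\<alpha> > 0" "\<alpha>' > 0"
    and V: "is_voiculescu_transform \<mu> \<alpha> \<beta> V" and V': "is_voiculescu_transform \<nu> \<alpha>' \<beta>' V'"
    and eq: "\<And>z. z \<in> truncated_cone (min \<alpha> \<alpha>') (max \<beta> \<beta>') \<Longrightarrow> V z = V' z"
  shows "\<mu> = \<nu>"
proof -
  obtain h where h: "is_right_inverse_on_cone \<mu> \<alpha> \<beta> h" "\<And>z. z \<in> truncated_cone \<alpha> \<beta> \<Longrightarrow> V z = h z - z"
    using V by (auto simp: is_voiculescu_transform_def)
  obtain k where k: "is_right_inverse_on_cone \<nu> \<alpha>' \<beta>' k" "\<And>z. z \<in> truncated_cone \<alpha>' \<beta>' \<Longrightarrow> V' z = k z - z"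
    using V' by (auto simp: is_voiculescu_transform_def)
  show ?thesis
  proof (rule eq_if_same_right_inverse[OF \<mu> _ right_inverse_on_cone_mono[OF h(1)] right_inverse_on_cone_mono[OF k(1)]])
    fix z assume z: "z \<in> truncated_cone (min \<alpha> \<alpha>') (max \<beta> \<beta>')"
    then have "z \<in> truncated_cone \<alpha> \<beta>" "z \<in> truncated_cone \<alpha>' \<beta>'"
      using truncated_cone_mono[of "min \<alpha> \<alpha>'" \<alpha> \<beta> "max \<beta> \<beta>'"] truncated_cone_mono[of "min \<alpha> \<alpha>'" \<alpha>' \<beta>' "max \<beta> \<beta>'"] by auto
    then show "h z = k z" using eq[OF z] h(2) k(2) by simp
  qed (use \<alpha> in auto)
qed

lemma voiculescu_transform_mono:
  assumes "is_voiculescu_transform \<mu> \<alpha> \<beta> V" "\<alpha>' \<le> \<alpha>" "\<beta> \<le> \<beta>'"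
  shows "is_voiculescu_transform \<mu> \<alpha>' \<beta>' V"
  using assms right_inverse_on_cone_mono[OF _ assms(2,3)] truncated_cone_mono[OF assms(2,3)]
  unfolding is_voiculescu_transform_def by blast

text \<open>A rival measure may come with its own cone and its own transform of \<mu>. On the
  intersection of the cones the two transforms of \<mu> agree, hence so do those of the
  rivals.\<close>

lemma free_power_eqI:
  assumes \<mu>: "real_distribution \<mu>" and \<rho>: "real_distribution \<rho>" and \<alpha>: "\<alpha> > 0" "\<beta> > 0"
    and V: "is_voiculescu_transform \<mu> \<alpha> \<beta> V" and W: "is_voiculescu_transform \<rho> \<alpha> \<beta> W"
    and eq: "\<And>z. z \<in> truncated_cone \<alpha> \<beta> \<Longrightarrow> W z = of_real t * V z"
  shows "free_power \<mu> t = \<rho>"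
  unfolding free_power_def
proof (rule the_equality)
  show "real_distribution \<rho> \<and> (\<exists>\<alpha>>0. \<exists>\<beta>>0. \<exists>V W. is_voiculescu_transform \<mu> \<alpha> \<beta> V \<and>
      is_voiculescu_transform \<rho> \<alpha> \<beta> W \<and> (\<forall>z\<in>truncated_cone \<alpha> \<beta>. W z = complex_of_real t * V z))"
    using \<rho> \<alpha> V W eq by blast
next
  fix \<rho>' assume "real_distribution \<rho>' \<and> (\<exists>\<alpha>>0. \<exists>\<beta>>0. \<exists>V W. is_voiculescu_transform \<mu> \<alpha> \<beta> V \<and>
      is_voiculescu_transform \<rho>' \<alpha> \<beta> W \<and> (\<forall>z\<in>truncated_cone \<alpha> \<beta>. W z = complex_of_real t * V z))"
  then obtain a b V' W' where \<rho>': "real_distribution \<rho>'" "a > 0" "b > 0" "is_voiculescu_transform \<mu> a b V'"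
    "is_voiculescu_transform \<rho>' a b W'" "\<And>z. z \<in> truncated_cone a b \<Longrightarrow> W' z = complex_of_real t * V' z"
    by blast
  show "\<rho>' = \<rho>"
  proof (rule eq_if_same_voiculescu_transform[OF \<rho>'(1) \<rho> \<rho>'(2) \<alpha>(1) \<rho>'(5) W])
    fix z assume z: "z \<in> truncated_cone (min a \<alpha>) (max b \<beta>)"
    then have "z \<in> truncated_cone \<alpha> \<beta>" "z \<in> truncated_cone a b"
      using truncated_cone_mono[of "min a \<alpha>" \<alpha> \<beta> "max b \<beta>"] truncated_cone_mono[of "min a \<alpha>" a b "max b \<beta>"] by auto
    then show "W' z = W z"
      using eq \<rho>'(6) voiculescu_transform_unique[OF \<mu> \<rho>'(2) \<alpha>(1) \<rho>'(4) V z] by simp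
  qed
qed

lemma free_conv_eqI:
  assumes \<mu>: "real_distribution \<mu>" and \<nu>: "real_distribution \<nu>" and \<rho>: "real_distribution \<rho>" and \<alpha>: "\<alpha> > 0" "\<beta> > 0"
    and V: "is_voiculescu_transform \<mu> \<alpha> \<beta> V" and U: "is_voiculescu_transform \<nu> \<alpha> \<beta> U"
    and W: "is_voiculescu_transform \<rho> \<alpha> \<beta> W"
    and eq: "\<And>z. z \<in> truncated_cone \<alpha> \<beta> \<Longrightarrow> W z = V z + U z"
  shows "free_conv \<mu> \<nu> = \<rho>"
  unfolding free_conv_def
proof (rule the_equality)
  show "real_distribution \<rho> \<and> (\<exists>\<alpha>>0. \<exists>\<beta>>0. \<exists>V U W. is_voiculescu_transform \<mu> \<alpha> \<beta> V \<and>
      is_voiculescu_transform \<nu> \<alpha> \<beta> U \<and> is_voiculescu_transform \<rho> \<alpha> \<beta> W \<and> (\<forall>z\<in>truncated_cone \<alpha> \<beta>. W z = V z + U z))"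
    using \<rho> \<alpha> V U W eq by blast
next
  fix \<rho>' assume "real_distribution \<rho>' \<and> (\<exists>\<alpha>>0. \<exists>\<beta>>0. \<exists>V U W. is_voiculescu_transform \<mu> \<alpha> \<beta> V \<and>
      is_voiculescu_transform \<nu> \<alpha> \<beta> U \<and> is_voiculescu_transform \<rho>' \<alpha> \<beta> W \<and> (\<forall>z\<in>truncated_cone \<alpha> \<beta>. W z = V z + U z))"
  then obtain a b V' U' W' where \<rho>': "real_distribution \<rho>'" "a > 0" "b > 0" "is_voiculescu_transform \<mu> a b V'"
    "is_voiculescu_transform \<nu> a b U'" "is_voiculescu_transform \<rho>' a b W'"
    "\<And>z. z \<in> truncated_cone a b \<Longrightarrow> W' z = V' z + U' z"
    by blast
  show "\<rho>' = \<rho>"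
  proof (rule eq_if_same_voiculescu_transform[OF \<rho>'(1) \<rho> \<rho>'(2) \<alpha>(1) \<rho>'(6) W])
    fix z assume z: "z \<in> truncated_cone (min a \<alpha>) (max b \<beta>)"
    then have "z \<in> truncated_cone \<alpha> \<beta>" "z \<in> truncated_cone a b"
      using truncated_cone_mono[of "min a \<alpha>" \<alpha> \<beta> "max b \<beta>"] truncated_cone_mono[of "min a \<alpha>" a b "max b \<beta>"] by auto
    then show "W' z = W z"
      using eq \<rho>'(7) voiculescu_transform_unique[OF \<mu> \<rho>'(2) \<alpha>(1) \<rho>'(4) V z]
        voiculescu_transform_unique[OF \<nu> \<rho>'(2) \<alpha>(1) \<rho>'(5) U z] by simp
  qed
qed

lemma boolean_power_eqI:
  assumes \<rho>: "real_distribution \<rho>"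
    and eq: "\<And>z. Im z > 0 \<Longrightarrow> reciprocal_cauchy \<rho> z = of_real t * reciprocal_cauchy \<mu> z + (1 - of_real t) * z"
  shows "boolean_power \<mu> t = \<rho>"
  unfolding boolean_power_def
proof (rule the_equality)
  show "real_distribution \<rho> \<and> (\<forall>z. Im z > 0 \<longrightarrow> reciprocal_cauchy \<rho> z =
        complex_of_real t * reciprocal_cauchy \<mu> z + (1 - complex_of_real t) * z)"
    using \<rho> eq by blast
  show "\<rho>' = \<rho>" if "real_distribution \<rho>' \<and> (\<forall>z. Im z > 0 \<longrightarrow> reciprocal_cauchy \<rho>' z =
        complex_of_real t * reciprocal_cauchy \<mu> z + (1 - complex_of_real t) * z)" for \<rho>'
    using that eq by (intro reciprocal_cauchy_unique[OF _ \<rho>]) auto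
qed

section \<open>Explicit right inverses for measures built from shift inverses\<close>

lemma sublinear_pick_scale:
  assumes N: "sublinear_pick N" and c: "c \<ge> 0"
  shows "sublinear_pick (\<lambda>z. of_real c * N z)"
  unfolding sublinear_pick_def
proof (intro conjI ballI)
  show "(\<lambda>z. of_real c * N z) holomorphic_on uhp"
    by (intro holomorphic_intros sublinear_pickD(1)[OF N])
  show "Im (of_real c * N z) \<ge> 0" if "z \<in> uhp" for z
    using sublinear_pickD(2)[OF N] that c by simp
  have "((\<lambda>y. of_real c * (N (\<i> * of_real y) / of_real y)) \<longlongrightarrow> of_real c * 0) at_top"
    by (intro tendsto_intros sublinear_pickD(3)[OF N])
  then show "((\<lambda>y. of_real c * N (\<i> * of_real y) / of_real y) \<longlongrightarrow> 0) at_top" by simp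
qed

text \<open>The reciprocal Cauchy transform is itself an inverse, so w - x M(w) is a right inverse
  of it wherever this value is in the half-plane. High up in the cone the correction is at most half
  the height, which guarantees that.\<close>

lemma voiculescu_transform_shift_inv:
  assumes M: "sublinear_pick M" and x: "x \<ge> 0"
    and \<sigma>: "\<And>z. Im z > 0 \<Longrightarrow> reciprocal_cauchy \<sigma> z = pick_shift_inv M x z"
  shows "\<exists>\<beta>>0. is_voiculescu_transform \<sigma> 1 \<beta> (\<lambda>z. - (of_real x * M z))"
proof -
  define h where "h z = z - of_real x * M z" for z
  have xM: "sublinear_pick (\<lambda>z. of_real x * M z)" by (rule sublinear_pick_scale[OF M x])
  obtain b where b: "b > 0" "\<And>z. z \<in> truncated_cone 1 b \<Longrightarrow> cmod (of_real x * M z) \<le> (1/2) * Im z"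
    using sublinear_pick_cone_le[OF xM, of "1/2" 1] by auto
  have uhp: "truncated_cone 1 b \<subseteq> uhp" by (auto simp: truncated_cone_def)
  have "is_right_inverse_on_cone \<sigma> 1 b h"
    unfolding is_right_inverse_on_cone_def
  proof (intro conjI ballI)
    show "h holomorphic_on truncated_cone 1 b"
      unfolding h_def
      by (intro holomorphic_intros holomorphic_on_subset[OF sublinear_pickD(1)[OF M] uhp])
    fix z assume z: "z \<in> truncated_cone 1 b"
    then have z0: "Im z > 0" using uhp by auto
    show h0: "Im (h z) > 0"
      using b(2)[OF z] abs_Im_le_cmod[of "of_real x * M z"] z0 unfolding h_def minus_complex.sel by linarith
    show "reciprocal_cauchy \<sigma> (h z) = z"
      unfolding \<sigma>[OF h0] by (rule pick_shift_inv_eqI[OF M x z0 _ h0]) (simp add: h_def)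
  next
    show "((\<lambda>z. h z / z) \<longlongrightarrow> 1) (inf at_infinity (principal (truncated_cone 1 b)))"
      unfolding tendsto_id_on_cone_iff[OF zero_less_one]
    proof (intro allI impI)
      fix e :: real assume "e > 0"
      from sublinear_pick_cone_le[OF xM this, of 1]
      obtain c where "\<And>z. z \<in> truncated_cone 1 c \<Longrightarrow> cmod (of_real x * M z) \<le> e * Im z" by blast
      then show "\<exists>c. \<forall>z\<in>truncated_cone 1 b. Im z > c \<longrightarrow> cmod (h z - z) \<le> e * Im z"
        by (intro exI[of _ c]) (auto simp: h_def truncated_cone_def)
    qed
  qed
  then have "is_voiculescu_transform \<sigma> 1 b (\<lambda>z. - (of_real x * M z))"
    unfolding is_voiculescu_transform_def by (intro exI[of _ h]) (simp add: h_def)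
  then show ?thesis using b(1) by blast
qed

text \<open>Let k be a right inverse for \<mu> and h(z) = z + (1 + t)(k(z) - z). Since N(k(z)) = z -
  k(z), also h(z) = k(z) - t N(k(z)), so the shift inverse sends h(z) to k(z), and the formula for
  \<rho> returns z.\<close>

lemma free_power_eq:
  assumes \<mu>: "real_distribution \<mu>" and \<rho>: "real_distribution \<rho>" and t: "t \<ge> 0"
    and N: "\<And>z. N z = reciprocal_cauchy \<mu> z - z"
    and F: "\<And>z. Im z > 0 \<Longrightarrow> reciprocal_cauchy \<rho> z = z + of_real (1 + t) * N (pick_shift_inv N t z)"
  shows "free_power \<mu> (1 + t) = \<rho>"
proof -
  have Np: "sublinear_pick N"
    using real_distribution.sublinear_pick_reciprocal_cauchy[OF \<mu>] N by presburger
  obtain b0 k where b0: "b0 > 0" and k0: "is_right_inverse_on_cone \<mu> 1 b0 k"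
    using exists_right_inverse_on_cone[OF \<mu>, of 1] by auto
  have klim: "\<exists>c. \<forall>z\<in>truncated_cone 1 b0. Im z > c \<longrightarrow> cmod (k z - z) \<le> e * Im z" if "e > 0" for e
    using k0 that unfolding is_right_inverse_on_cone_def tendsto_id_on_cone_iff[OF zero_less_one] by blast
  \<comment> \<open>This tolerance keeps the displacement (1 + t)(k(z) - z) within half the height,
    so that h(z) stays in the half-plane.\<close>
  have "1 / (2 * (1 + t)) > 0" using t by simp
  from klim[OF this] obtain c where
    c: "\<And>z. z \<in> truncated_cone 1 b0 \<Longrightarrow> Im z > c \<Longrightarrow> cmod (k z - z) \<le> 1 / (2 * (1 + t)) * Im z" by blast
  define b where "b = max b0 c"
  have b: "b > 0" "b \<ge> b0" "b \<ge> c" using b0 by (auto simp: b_def)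
  have k: "is_right_inverse_on_cone \<mu> 1 b k" by (rule right_inverse_on_cone_mono[OF k0]) (use b in auto)
  define h where "h z = z + of_real (1 + t) * (k z - z)" for z
  have sub: "truncated_cone 1 b \<subseteq> truncated_cone 1 b0" by (rule truncated_cone_mono) (use b in auto)
  have "is_right_inverse_on_cone \<rho> 1 b h"
    unfolding is_right_inverse_on_cone_def
  proof (intro conjI ballI)
    show "h holomorphic_on truncated_cone 1 b"
      unfolding h_def using k by (intro holomorphic_intros) (simp add: is_right_inverse_on_cone_def)
    fix z assume z: "z \<in> truncated_cone 1 b"
    then have z0: "Im z > 0" "Im z > c" using b by (auto simp: truncated_cone_def)
    have kz: "Im (k z) > 0" "k z + N (k z) = z"
      using k z by (auto simp: is_right_inverse_on_cone_def N)
    have "cmod (of_real (1 + t) * (k z - z)) = (1 + t) * cmod (k z - z)"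
      using t unfolding norm_mult norm_of_real by simp
    also have "\<dots> \<le> (1 + t) * (1 / (2 * (1 + t)) * Im z)"
      using c[of z] z sub z0 t by (intro mult_left_mono) auto
    also have "\<dots> = Im z / 2" using t by (simp add: field_simps)
    finally show h0: "Im (h z) > 0"
      using abs_Im_le_cmod[of "of_real (1 + t) * (k z - z)"] z0 unfolding h_def plus_complex.sel by linarith
    have Nk: "N (k z) = z - k z" using kz(2) by (simp add: algebra_simps)
    have "pick_shift_inv N t (h z) = k z"
      by (rule pick_shift_inv_eqI[OF Np t kz(1) _ h0]) (simp add: h_def Nk algebra_simps)
    then show "reciprocal_cauchy \<rho> (h z) = z"
      unfolding F[OF h0] by (simp add: Nk h_def algebra_simps)
  next
    show "((\<lambda>z. h z / z) \<longlongrightarrow> 1) (inf at_infinity (principal (truncated_cone 1 b)))"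
      unfolding tendsto_id_on_cone_iff[OF zero_less_one]
    proof (intro allI impI)
      fix e :: real assume e: "e > 0"
      then have "e / (1 + t) > 0" using t by simp
      from klim[OF this] obtain d where
        d: "\<And>z. z \<in> truncated_cone 1 b0 \<Longrightarrow> Im z > d \<Longrightarrow> cmod (k z - z) \<le> e / (1 + t) * Im z" by blast
      have "cmod (h z - z) \<le> e * Im z" if z: "z \<in> truncated_cone 1 b" "Im z > d" for z
      proof -
        have "cmod (h z - z) = (1 + t) * cmod (k z - z)"
          using t unfolding h_def add_diff_cancel_left' norm_mult norm_of_real by simp
        also have "\<dots> \<le> (1 + t) * (e / (1 + t) * Im z)"
          using d[of z] z sub t by (intro mult_left_mono) auto
        also have "\<dots> = e * Im z" using t by simp
        finally show ?thesis .
      qed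
      then show "\<exists>d. \<forall>z\<in>truncated_cone 1 b. Im z > d \<longrightarrow> cmod (h z - z) \<le> e * Im z" by blast
    qed
  qed
  then have W: "is_voiculescu_transform \<rho> 1 b (\<lambda>z. of_real (1 + t) * (k z - z))"
    unfolding is_voiculescu_transform_def by (intro exI[of _ h]) (simp add: h_def)
  have V: "is_voiculescu_transform \<mu> 1 b (\<lambda>z. k z - z)"
    using k unfolding is_voiculescu_transform_def by blast
  show ?thesis by (rule free_power_eqI[OF \<mu> \<rho> zero_less_one b(1) V W]) simp
qed

section \<open>The free convolution semigroup passing through \<open>B_transform t \<mu>\<close> at
  time 1\<close>

theorem mainTheorem3:
  fixes t :: real and \<mu> :: "real measure"
  assumes "t \<ge> 1" and "real_distribution \<mu>"
  shows "free_infinitely_divisible (B_transform t \<mu>)"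
proof -
  define N where "N z = reciprocal_cauchy \<mu> z - z" for z
  have N: "sublinear_pick N"
    using real_distribution.sublinear_pick_reciprocal_cauchy[OF assms(2)] by (simp add: N_def[abs_def])
  have t: "t \<ge> 0" "t - 1 \<ge> 0" using assms by auto
  define \<omega> where "\<omega> = pick_shift_inv N t"
  have N\<omega>: "sublinear_pick (\<lambda>z. N (\<omega> z))"
    unfolding \<omega>_def by (rule sublinear_pick_compose_shift_inv[OF N t(1)])
  define M where "M z = N (pick_shift_inv N (t - 1) z)" for z
  have M: "sublinear_pick M"
    unfolding M_def[abs_def] by (rule sublinear_pick_compose_shift_inv[OF N t(2)])
  have "sublinear_pick (\<lambda>z. of_real (1 + t) * N (\<omega> z))"
    by (rule sublinear_pick_scale[OF N\<omega>]) (use t in auto)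
  from exists_real_distribution_reciprocal_cauchy[OF this] obtain \<rho> where
    \<rho>: "real_distribution \<rho>" "\<And>z. Im z > 0 \<Longrightarrow> reciprocal_cauchy \<rho> z = z + of_real (1 + t) * N (\<omega> z)"
    by auto
  have power: "free_power \<mu> (1 + t) = \<rho>"
    by (rule free_power_eq[OF assms(2) \<rho>(1) t(1) N_def]) (simp add: \<rho>(2) \<omega>_def)
  have "\<exists>\<sigma>. real_distribution \<sigma> \<and> (\<forall>z\<in>uhp. reciprocal_cauchy \<sigma> z = pick_shift_inv M x z)" if x: "x \<ge> 0" for x
  proof -
    have "sublinear_pick (\<lambda>z. of_real x * M (pick_shift_inv M x z))"
      by (rule sublinear_pick_scale[OF sublinear_pick_compose_shift_inv[OF M x] x])
    from exists_real_distribution_reciprocal_cauchy[OF this] obtain \<sigma> where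
      \<sigma>: "real_distribution \<sigma>" "\<And>z. Im z > 0 \<Longrightarrow> reciprocal_cauchy \<sigma> z = z + of_real x * M (pick_shift_inv M x z)"
      by auto
    \<comment> \<open>The defining relation of the shift inverse reads
      \<open>pick_shift_inv M x z\<close> = z + x M at that point, so the two descriptions of F
      coincide.\<close>
    have "reciprocal_cauchy \<sigma> z = pick_shift_inv M x z" if "Im z > 0" for z
      using \<sigma>(2)[OF that] pick_shift_inv(2)[OF M x that] by (metis add.commute diff_eq_eq)
    then show ?thesis using \<sigma>(1) by auto
  qed
  then obtain \<sigma> where \<sigma>: "\<And>x. x \<ge> 0 \<Longrightarrow> real_distribution (\<sigma> x)"
    "\<And>x z. x \<ge> 0 \<Longrightarrow> Im z > 0 \<Longrightarrow> reciprocal_cauchy (\<sigma> x) z = pick_shift_inv M x z"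
    by (metis mem_Collect_eq)
  have "reciprocal_cauchy (\<sigma> 1) z = of_real (1 / (1 + t)) * reciprocal_cauchy \<rho> z + (1 - of_real (1 / (1 + t))) * z"
    if z: "Im z > 0" for z
  proof -
    have w: "Im (\<omega> z) > 0" "\<omega> z - of_real t * N (\<omega> z) = z"
      unfolding \<omega>_def by (rule pick_shift_inv[OF N t(1) z])+
    have pos: "Im (z + N (\<omega> z)) > 0" using sublinear_pickD(2)[OF N w(1)] z by simp
    \<comment> \<open>Here u = z + N(\<omega>(z)) lies in the half-plane and is the shift of
      \<omega>(z) with coefficient t - 1. This identifies \<omega>(z) as the shift inverse at u,
      whence M(u) = N(\<omega>(z)) and u - M(u) = z.\<close>
    have "z + N (\<omega> z) = \<omega> z - of_real (t - 1) * N (\<omega> z)"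
      using w(2) by (simp add: algebra_simps)
    then have "pick_shift_inv N (t - 1) (z + N (\<omega> z)) = \<omega> z"
      by (intro pick_shift_inv_eqI[OF N t(2) w(1) _ pos]) simp
    then have "M (z + N (\<omega> z)) = N (\<omega> z)" by (simp add: M_def)
    then have "pick_shift_inv M 1 z = z + N (\<omega> z)"
      by (intro pick_shift_inv_eqI[OF M _ pos _ z]) auto
    moreover have "complex_of_real (1 / (1 + t)) * of_real (1 + t) = 1"
      unfolding of_real_mult[symmetric] using t by simp
    moreover have "c * (z + d * n) + (1 - c) * z = z + (c * d) * n" for c d n :: complex
      by (simp add: algebra_simps)
    ultimately show ?thesis using \<sigma>(2)[OF _ z, of 1] \<rho>(2)[OF z] by (simp only: zero_le_one mult_1)
  qed
  then have "boolean_power \<rho> (1 / (1 + t)) = \<sigma> 1"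
    by (intro boolean_power_eqI \<sigma>(1)) auto
  then have B: "B_transform t \<mu> = \<sigma> 1" by (simp add: B_transform_def power)
  have vt: "\<exists>\<beta>>0. is_voiculescu_transform (\<sigma> x) 1 \<beta> (\<lambda>z. - (of_real x * M z))" if "x \<ge> 0" for x
    by (rule voiculescu_transform_shift_inv[OF M that]) (rule \<sigma>(2)[OF that])
  \<comment> \<open>The transforms are linear in the parameter x, so they add; the largest of the
    three heights gives a common cone.\<close>
  have conv: "free_conv (\<sigma> x) (\<sigma> y) = \<sigma> (x + y)" if nn: "x \<ge> 0" "y \<ge> 0" for x y
  proof -
    have xy: "x + y \<ge> 0" using nn by simp
    obtain a b c where a: "a > 0" "is_voiculescu_transform (\<sigma> x) 1 a (\<lambda>z. - (of_real x * M z))"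
      and b: "b > 0" "is_voiculescu_transform (\<sigma> y) 1 b (\<lambda>z. - (of_real y * M z))"
      and c: "c > 0" "is_voiculescu_transform (\<sigma> (x + y)) 1 c (\<lambda>z. - (of_real (x + y) * M z))"
      using vt[OF nn(1)] vt[OF nn(2)] vt[OF xy] by blast
    let ?m = "max a (max b c)"
    show ?thesis
      by (rule free_conv_eqI[OF \<sigma>(1)[OF nn(1)] \<sigma>(1)[OF nn(2)] \<sigma>(1)[OF xy] zero_less_one _
            voiculescu_transform_mono[OF a(2), of 1 ?m] voiculescu_transform_mono[OF b(2), of 1 ?m]
            voiculescu_transform_mono[OF c(2), of 1 ?m]])
         (use a(1) in \<open>auto simp: algebra_simps\<close>)
  qed
  have iter: "(free_conv (\<sigma> x) ^^ k) (\<sigma> x) = \<sigma> (real (Suc k) * x)" if "x \<ge> 0" for x k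
  proof (induction k)
    case (Suc k)
    have "(free_conv (\<sigma> x) ^^ Suc k) (\<sigma> x) = free_conv (\<sigma> x) (\<sigma> (real (Suc k) * x))"
      using Suc by simp
    also have "\<dots> = \<sigma> (x + real (Suc k) * x)" using that by (intro conv) auto
    also have "x + real (Suc k) * x = real (Suc (Suc k)) * x" by (simp add: algebra_simps)
    finally show ?case .
  qed simp
  have "\<exists>\<mu>\<^sub>n. real_distribution \<mu>\<^sub>n \<and> free_conv_nfold n \<mu>\<^sub>n = \<sigma> 1" if n: "n \<ge> 1" for n :: nat
  proof (intro exI conjI)
    show "real_distribution (\<sigma> (1 / real n))" by (rule \<sigma>(1)) simp
    have nonneg: "1 / real n \<ge> 0" by simp
    \<comment> \<open>The n-fold convolution applies n - 1 convolutions to a first copy, so Suc (n -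
      1) = n copies of time 1/n add up to time 1.\<close>
    have one: "real (Suc (n - 1)) * (1 / real n) = 1" using n by simp
    show "free_conv_nfold n (\<sigma> (1 / real n)) = \<sigma> 1"
      using iter[OF nonneg, of "n - 1"] unfolding free_conv_nfold_def one .
  qed
  then show ?thesis
    unfolding free_infinitely_divisible_def B using \<sigma>(1)[of 1] by auto
qed

end
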